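(* Let $m=(m_1,m_2,m_3,m_3)$ be a multiplicity with $m_1,m_2\in 2\mathbb{Z}+1$ and $|m|\in 4\mathbb{Z}$. If $2m_i\le |m|+2$ for all $i$, then $\theta_m\in D(m)$ and $\exp(m)=\left(\frac{|m|}{2}-1,\frac{|m|}{2}+1\right)$. Moreover, if $m$ is balanced, then $D(m)$ is generated as an $S$-module by $\theta_m$ and $\theta_{m''}$, where $m''=(m_1+2,m_2+2,m_3,m_3)$.
   Context: Let $\mathbb{K}$ be a field of characteristic zero, $S=\mathbb{K}[x,y]$, $S_k$ the space of homogeneous polynomials of degree $k$, and $\mathrm{Der}(S)=\{f\partial_x+g\partial_y : f,g\in S\}$, acting on polynomials by $\theta(h)=f\,\partial h/\partial x+g\,\partial h/\partial y$; $\theta=f\partial_x+g\partial_y$ is homogeneous of degree $k$ if $f,g\in S_k$. Put $\alpha_1=x$, $\alpha_2=y$, $\alpha_3=x-y$, $\alpha_4=x+y$ (their kernels form the Coxeter arrangement of type $B_2$). For a multiplicity $m=(m_1,m_2,m_3,m_4)\in\mathbb{Z}_{\ge 0}^4$ let $|m|=m_1+m_2+m_3+m_4$ and $D(m)=\{\theta\in\mathrm{Der}(S):\theta(\alpha_i)\in\alpha_i^{m_i}S\ \text{for } i=1,2,3,4\}$. $D(m)$ is a free $S$-module of rank $2$ admitting a homogeneous basis; $\exp(m)$ denotes the multiset of degrees of the elements of a homogeneous basis. The multiplicity $m$ is balanced if $2m_i\le |m|-1$ for all $i$. For real $a$ and integer $n\ge0$ let $\langle a\rangle_n=\prod_{j=0}^{n-1}(a+2j)$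 (with $\langle a\rangle_0=1$); for an integer $n\ge 0$, $n!!$ is the double factorial with $0!!=1$. For $m=(m_1,m_2,m_3,m_3)$ with $m_1,m_2$ odd and $|m|\in4\mathbb{Z}$, let $d=\frac{|m|}{2}-1$ and define $f_m=\sum_{i=0}^{(d-m_1)/2}(-1)^i\frac{\langle m_1+m_2-d\rangle_{(d-m_1)/2-i}}{(d-m_1-2i)!!\,(d-2i)!!\,(2i)!!}x^{d-2i}y^{2i}$, $g_m=\sum_{i=0}^{(d-m_2)/2}(-1)^{i+m_3}\frac{\langle m_1+m_2-d\rangle_{(d-m_2)/2-i}}{(d-m_2-2i)!!\,(d-2i)!!\,(2i)!!}x^{2i}y^{d-2i}$, where a sum whose upper limit is negative is $0$, and $\theta_m=f_m\partial_x-g_m\partial_y$. *)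

theory Defs
  imports
    Complex_Main
    "HOL-Library.Multiset"
    "HOL-Library.Product_Plus"
    "HOL-Computational_Algebra.Polynomial"
begin

text \<open>
  The ring \<open>K[x,y]\<close> is represented as \<open>K[x][y]\<close>: the coefficient of
  \<open>x ^ i * y ^ j\<close> in \<open>p\<close> is \<open>coeff (coeff p j) i\<close>.
\<close>

type_synonym 'a bipoly = "'a poly poly"

definition X :: "'a::comm_ring_1 bipoly" where
  "X = [:[:0, 1:]:]"

definition Y :: "'a::comm_ring_1 bipoly" where
  "Y = [:0, 1:]"

definition dx :: "'a::idom bipoly \<Rightarrow> 'a bipoly" where
  "dx p = map_poly pderiv p"

definition dy :: "'a::idom bipoly \<Rightarrow> 'a bipoly" where
  "dy p = pderiv p"

definition homogeneous_polys :: "nat \<Rightarrow> 'a::comm_ring_1 bipoly set" where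
  "homogeneous_polys k = {p. \<forall>i j. coeff (coeff p j) i \<noteq> 0 \<longrightarrow> i + j = k}"

text \<open>The pair \<open>(f, g)\<close> stands for the derivation \<open>f \<partial>\<^sub>x + g \<partial>\<^sub>y\<close>.\<close>

type_synonym 'a derivation = "'a bipoly \<times> 'a bipoly"

definition der_apply :: "'a::idom derivation \<Rightarrow> 'a bipoly \<Rightarrow> 'a bipoly" where
  "der_apply \<theta> h = fst \<theta> * dx h + snd \<theta> * dy h"

definition der_scale :: "'a::idom bipoly \<Rightarrow> 'a derivation \<Rightarrow> 'a derivation" where
  "der_scale p \<theta> = (p * fst \<theta>, p * snd \<theta>)"

definition der_homogeneous :: "nat \<Rightarrow> 'a::idom derivation \<Rightarrow> bool" where
  "der_homogeneous k \<theta> \<longleftrightarrow> fst \<theta> \<in> homogeneous_polys k \<and> snd \<theta> \<in> homogeneous_polys k"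

interpretation Der: module der_scale
  by unfold_locales
    (auto simp: der_scale_def algebra_simps prod_eq_iff)

definition homogeneous_basis ::
    "'a::idom derivation set \<Rightarrow> ('a derivation \<Rightarrow> nat) \<Rightarrow> 'a derivation set \<Rightarrow> bool" where
  "homogeneous_basis M e B \<longleftrightarrow>
     finite B \<and> \<not> module.dependent der_scale B \<and> module.span der_scale B = M \<and>
     (\<forall>\<theta>\<in>B. der_homogeneous (e \<theta>) \<theta>)"

definition exponents :: "'a::idom derivation set \<Rightarrow> nat multiset" where
  "exponents M = (THE E. \<exists>e B. homogeneous_basis M e B \<and> E = image_mset e (mset_set B))"

text \<open>
  Multiplicities are lists of length 4; the list position \<open>i\<close> (starting from 0) of
  a multiplicity belongs to the \<open>i\<close>-th linear form.
\<close>

definition linear_forms :: "'a::comm_ring_1 bipoly list" where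
  "linear_forms = [X, Y, X - Y, X + Y]"

definition D :: "nat list \<Rightarrow> 'a::idom derivation set" where
  "D m = {\<theta>. \<forall>i<4. (linear_forms ! i) ^ (m ! i) dvd der_apply \<theta> (linear_forms ! i)}"

definition balanced :: "nat list \<Rightarrow> bool" where
  "balanced m \<longleftrightarrow> (\<forall>i<4. 2 * int (m ! i) \<le> int (sum_list m) - 1)"

definition step2_prod :: "'a::comm_ring_1 \<Rightarrow> nat \<Rightarrow> 'a" where
  "step2_prod a n = (\<Prod>j<n. a + 2 * of_nat j)"

fun dfact :: "nat \<Rightarrow> nat" where
  "dfact 0 = 1"
| "dfact (Suc 0) = 1"
| "dfact (Suc (Suc n)) = Suc (Suc n) * dfact n"

text \<open>
  The following three definitions are meant for \<open>m1\<close>, \<open>m2\<close> odd and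
  \<open>m1 + m2 + 2 * m3\<close> divisible by 4. Then no division below has a remainder,
  and no subtraction of natural numbers is truncated.
\<close>

definition f_poly :: "nat \<Rightarrow> nat \<Rightarrow> nat \<Rightarrow> 'a::field_char_0 bipoly" where
  "f_poly m1 m2 m3 =
    (let d = sum_list [m1, m2, m3, m3] div 2 - 1 in
     if m1 \<le> d then
       \<Sum>i = 0..(d - m1) div 2.
         [:[:(-1) ^ i * step2_prod (of_int (int m1 + int m2 - int d)) ((d - m1) div 2 - i) /
             of_nat (dfact (d - m1 - 2 * i) * dfact (d - 2 * i) * dfact (2 * i)):]:] *
         X ^ (d - 2 * i) * Y ^ (2 * i)
     else 0)"

definition g_poly :: "nat \<Rightarrow> nat \<Rightarrow> nat \<Rightarrow> 'a::field_char_0 bipoly" where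
  "g_poly m1 m2 m3 =
    (let d = sum_list [m1, m2, m3, m3] div 2 - 1 in
     if m2 \<le> d then
       \<Sum>i = 0..(d - m2) div 2.
         [:[:(-1) ^ (i + m3) * step2_prod (of_int (int m1 + int m2 - int d)) ((d - m2) div 2 - i) /
             of_nat (dfact (d - m2 - 2 * i) * dfact (d - 2 * i) * dfact (2 * i)):]:] *
         X ^ (2 * i) * Y ^ (d - 2 * i)
     else 0)"

definition theta :: "nat \<Rightarrow> nat \<Rightarrow> nat \<Rightarrow> 'a::field_char_0 derivation" where
  "theta m1 m2 m3 = (f_poly m1 m2 m3, - g_poly m1 m2 m3)"

end

theory Submission
  imports Defs
begin

text \<open>
  Viewed as polynomials in \<open>y\<close> over \<open>K[x]\<close>, both \<open>f\<^sub>m\<close> and \<open>g\<^sub>m\<close> solve the homogeneous form of one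
  hypergeometric equation, because their coefficients obey the same two-term recursion. Its points
  \<open>y = \<plusminus>x\<close> are regular singular with local exponents \<open>0\<close> and \<open>m\<^sub>3\<close>, so a polynomial solution that
  vanishes there is divisible by \<open>(y \<mp> x)\<close> to the power \<open>m\<^sub>3\<close>. By Chu-Vandermonde the values of
  \<open>f\<^sub>m\<close> and \<open>g\<^sub>m\<close> at \<open>y = \<plusminus>x\<close> cancel, which gives \<open>\<theta>\<^sub>m \<in> D(m)\<close>. A second element of degree \<open>d + 2\<close> is
  \<open>\<theta>\<close> of a multiplicity of size \<open>|m| + 4\<close> above \<open>m\<close>, and Saito's criterion shows that the two form a basis:
  their determinant is nonzero, homogeneous of degree \<open>|m|\<close>, and divisible by the product of the
  \<open>\<alpha>\<^sub>i\<close> to the powers \<open>m\<^sub>i\<close>.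
\<close>

section \<open>Regular singular points\<close>

text \<open>
  If \<open>h\<close> has a zero of order \<open>k\<close> at \<open>r\<close>, then the coefficient of lowest order in the equation is \<open>k\<close> times
  the expression of the assumption \<open>indicial\<close>, times a nonzero factor.
\<close>

lemma power_dvd_of_regular_singular_ode:
  fixes h A B C :: "'b::{idom,ring_char_0} poly"
  assumes ode: "[:- r, 1:] * A * pderiv (pderiv h) + B * pderiv h + C * h = 0"
    and root: "poly h r = 0"
    and indicial: "\<And>k. 1 \<le> k \<Longrightarrow> k < n \<Longrightarrow> of_nat (k - 1) * poly A r + poly B r \<noteq> 0"
  shows "[:- r, 1:] ^ n dvd h"
proof (cases "h = 0")
  case False
  define L where "L = [:- r, 1:]"
  obtain q where h: "h = L ^ order r h * q" and nd: "\<not> L dvd q"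
    using order_decomp[OF False, of r] unfolding L_def by blast
  define j where "j = order r h - 1"
  have "order r h > 0" using root False by (simp add: order_root)
  then have k: "order r h = Suc j" by (simp add: j_def)
  have qr: "poly q r \<noteq> 0" using nd by (simp add: poly_eq_0_iff_dvd L_def)
  have L': "pderiv L = 1" by (simp add: pderiv_pCons L_def)
  have Lr: "poly L r = 0" by (simp add: L_def)
  have smult_of_nat: "smult (of_nat i) p = of_nat i * p" for i and p :: "'b poly"
    by (simp add: of_nat_poly)
  define u where "u = of_nat (Suc j) * q + L * pderiv q"
  have h': "pderiv h = L ^ j * u"
    by (subst h, unfold k pderiv_mult pderiv_power_Suc L')
      (simp add: u_def smult_of_nat algebra_simps del: of_nat_Suc)
  \<comment> \<open>The extra factor \<open>L\<close>, supplied by the leading coefficient of the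
    equation, avoids the exponent \<open>j - 1\<close>, which would truncate at
    \<open>j = 0\<close>.\<close>
  have h'': "L * pderiv (pderiv h) = L ^ j * (of_nat j * u + L * pderiv u)"
  proof (cases j)
    case 0
    then show ?thesis unfolding h' by simp
  next
    case (Suc i)
    show ?thesis unfolding h' Suc pderiv_mult pderiv_power_Suc L'
      by (simp add: smult_of_nat algebra_simps del: of_nat_Suc)
  qed
  \<comment> \<open>Once \<open>L ^ j\<close> is cancelled, evaluation at \<open>r\<close> kills
    every term with a further factor \<open>L\<close> and leaves the indicial expression times
    \<open>(j + 1) * q(r)\<close>.\<close>
  have "L ^ j * (A * (of_nat j * u + L * pderiv u) + B * u + C * (L * q))
      = A * (L * pderiv (pderiv h)) + B * pderiv h + C * h"
    unfolding h'' unfolding h' by (subst h, unfold k) (simp add: algebra_simps)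
  also have "\<dots> = 0" using ode unfolding L_def[symmetric] by (simp only: mult_ac)
  finally have "A * (of_nat j * u + L * pderiv u) + B * u + C * (L * q) = 0"
    by (simp add: L_def)
  then have "poly (A * (of_nat j * u + L * pderiv u) + B * u + C * (L * q)) r = 0"
    by simp
  then have "(of_nat j * poly A r + poly B r) * (of_nat (Suc j) * poly q r) = 0"
    by (simp add: u_def Lr algebra_simps)
  then have "of_nat j * poly A r + poly B r = 0"
    using qr by (simp del: of_nat_Suc)
  then have "\<not> order r h < n" using indicial[of "order r h"] k by auto
  then show ?thesis by (simp add: order_divides)
qed simp

section \<open>Homogeneous polynomials\<close>

text \<open>Scalars get a constant of their own so that the rules below treat the embedding of K as
  a ring homomorphism and nested coefficient lists stay folded.\<close>

definition cst :: "'a::comm_ring_1 \<Rightarrow> 'a bipoly" where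
  "cst c = [:[:c:]:]"

lemma cst_hom [simp]:
  "cst (a * b) = cst a * cst b" "cst (a + b) = cst a + cst b" "cst (a - b) = cst a - cst b"
  "cst 1 = 1" "cst 0 = 0" "cst (of_nat n) = of_nat n" "cst (- a) = - cst a"
  by (simp_all add: cst_def of_nat_poly one_pCons)

lemma dx_add [simp]: "dx (p + q) = dx p + dx q"
  by (rule poly_eqI) (simp add: dx_def coeff_map_poly pderiv_add)

lemma dx_mult: "dx (p * q) = dx p * q + p * dx q"
  \<comment> \<open>The instance of \<open>higher_pderiv_sum\<close> for one derivative lets
    \<open>pderiv\<close> pass through the convolution sum.\<close>
  by (rule poly_eqI)
    (simp add: dx_def coeff_map_poly coeff_mult higher_pderiv_sum[of 1, simplified] pderiv_mult
      flip: sum.distrib, simp add: algebra_simps)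

lemma dx_X [simp]: "dx X = 1" and dx_Y [simp]: "dx Y = 0"
  and dy_X [simp]: "dy X = 0" and dy_Y [simp]: "dy Y = 1"
  by (simp_all add: dx_def dy_def X_def Y_def map_poly_pCons pderiv_pCons one_pCons)

lemma dy_add: "dy (p + q) = dy p + dy q" and dy_mult: "dy (p * q) = dy p * q + p * dy q"
  by (simp_all add: dy_def pderiv_add pderiv_mult algebra_simps)

definition euler :: "'a::idom bipoly \<Rightarrow> 'a bipoly" where
  "euler p = X * dx p + Y * dy p"

lemma euler_mult: "euler (p * q) = euler p * q + p * euler q"
  by (simp add: euler_def dx_mult dy_mult algebra_simps)

lemma coeff_euler: "coeff (coeff (euler p) j) i = of_nat (i + j) * coeff (coeff p j) i"
proof -
  have "coeff (coeff (X * dx p) j) i = of_nat i * coeff (coeff p j) i"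
    by (cases i) (simp_all add: X_def dx_def coeff_map_poly coeff_pderiv)
  moreover have "coeff (coeff (Y * dy p) j) i = of_nat j * coeff (coeff p j) i"
    by (cases j) (simp_all add: Y_def dy_def coeff_pderiv of_nat_poly del: of_nat_Suc)
  ultimately show ?thesis by (simp add: euler_def algebra_simps)
qed

text \<open>
  In characteristic zero the derivation \<open>euler\<close> detects degrees, so that facts about products and
  quotients of homogeneous polynomials reduce to the Leibniz rule.
\<close>

lemma homogeneous_iff_euler:
  fixes p :: "'a::{idom,ring_char_0} bipoly"
  shows "p \<in> homogeneous_polys k \<longleftrightarrow> euler p = of_nat k * p"
proof -
  have "coeff (coeff (of_nat k * p) j) i = of_nat k * coeff (coeff p j) i" for i j
    by (simp add: of_nat_poly)
  then have "euler p = of_nat k * p \<longleftrightarrow>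
      (\<forall>j i. of_nat (i + j) * coeff (coeff p j) i = of_nat k * coeff (coeff p j) i)"
    by (simp only: poly_eq_iff coeff_euler)
  then show ?thesis
    by (auto simp: homogeneous_polys_def simp del: of_nat_add)
qed

lemma homogeneous_add:
  "p \<in> homogeneous_polys k \<Longrightarrow> q \<in> homogeneous_polys k \<Longrightarrow> p + q \<in> homogeneous_polys k"
  unfolding homogeneous_polys_def by (simp, metis add_0)

lemma homogeneous_uminus: "p \<in> homogeneous_polys k \<Longrightarrow> - p \<in> homogeneous_polys k"
  by (simp add: homogeneous_polys_def)

lemma homogeneous_diff:
  "p \<in> homogeneous_polys k \<Longrightarrow> q \<in> homogeneous_polys k \<Longrightarrow> p - q \<in> homogeneous_polys k"
  using homogeneous_add[OF _ homogeneous_uminus] by fastforce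

lemma homogeneous_0: "0 \<in> homogeneous_polys k"
  by (simp add: homogeneous_polys_def)

lemma homogeneous_sum:
  "(\<And>i. i \<in> I \<Longrightarrow> p i \<in> homogeneous_polys k) \<Longrightarrow> sum p I \<in> homogeneous_polys k"
  by (induction I rule: infinite_finite_induct) (auto intro: homogeneous_add homogeneous_0)

lemma homogeneous_mult:
  fixes p q :: "'a::{idom,ring_char_0} bipoly"
  assumes "p \<in> homogeneous_polys k" "q \<in> homogeneous_polys l"
  shows "p * q \<in> homogeneous_polys (k + l)"
  using assms by (simp add: homogeneous_iff_euler euler_mult algebra_simps)

lemma homogeneous_cst: "cst c \<in> homogeneous_polys 0"
  by (auto simp: homogeneous_polys_def cst_def coeff_pCons split: nat.splits)

lemma homogeneous_X: "X \<in> homogeneous_polys 1" and homogeneous_Y: "Y \<in> homogeneous_polys 1"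
  by (auto simp: homogeneous_polys_def X_def Y_def coeff_pCons one_pCons split: nat.splits if_splits)

lemma homogeneous_power:
  fixes p :: "'a::{idom,ring_char_0} bipoly"
  assumes "p \<in> homogeneous_polys 1"
  shows "p ^ n \<in> homogeneous_polys n"
proof (induction n)
  case 0
  then show ?case using homogeneous_cst[of 1] by simp
next
  case (Suc n)
  then show ?case using homogeneous_mult[OF assms Suc] by simp
qed

text \<open>The Leibniz rule for \<open>euler\<close>, after cancelling \<open>q\<close>, gives
  \<open>euler p + s p = t p\<close>. So every monomial of \<open>p\<close> has degree
  \<open>i + j\<close> with \<open>i + j + s = t\<close>, and a nonzero \<open>p\<close> has at
  least one.\<close>

lemma homogeneous_left_factor:
  fixes p q :: "'a::{idom,ring_char_0} bipoly"
  assumes pq: "p * q \<in> homogeneous_polys t" and q: "q \<in> homogeneous_polys s"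
    and "p \<noteq> 0" "q \<noteq> 0"
  shows "s \<le> t" "p \<in> homogeneous_polys (t - s)"
proof -
  have "(euler p + of_nat s * p) * q = of_nat t * p * q"
    using pq q by (simp add: homogeneous_iff_euler euler_mult algebra_simps)
  then have E: "euler p + of_nat s * p = of_nat t * p"
    using \<open>q \<noteq> 0\<close> by simp
  have ij: "i + j + s = t" if "coeff (coeff p j) i \<noteq> 0" for i j
  proof -
    have "coeff (coeff (euler p + of_nat s * p) j) i = coeff (coeff (of_nat t * p) j) i"
      using E by simp
    then have "of_nat (i + j + s) * coeff (coeff p j) i = of_nat t * coeff (coeff p j) i"
      by (simp add: coeff_euler of_nat_poly algebra_simps)
    then show ?thesis using that by (simp del: of_nat_add)
  qed
  have "\<exists>j i. coeff (coeff p j) i \<noteq> 0"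
    using \<open>p \<noteq> 0\<close> by (metis coeff_0 poly_eqI)
  then show "s \<le> t" using ij by force
  show "p \<in> homogeneous_polys (t - s)" using ij by (force simp: homogeneous_polys_def)
qed

section \<open>Modules of derivations of rank two\<close>

text \<open>The determinant of the Saito matrix of the two derivations.\<close>

definition der_det :: "'a::idom derivation \<Rightarrow> 'a derivation \<Rightarrow> 'a bipoly" where
  "der_det \<theta> \<eta> = fst \<theta> * snd \<eta> - snd \<theta> * fst \<eta>"

lemma homogeneous_der_det:
  fixes \<theta> \<eta> :: "'a::{idom,ring_char_0} derivation"
  assumes "der_homogeneous k \<theta>" "der_homogeneous l \<eta>"
  shows "der_det \<theta> \<eta> \<in> homogeneous_polys (k + l)"
  using assms by (auto simp: der_det_def der_homogeneous_def intro!: homogeneous_diff homogeneous_mult)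

lemma mem_span_pair_iff:
  "\<theta> \<in> module.span der_scale {a, b} \<longleftrightarrow> (\<exists>p q. \<theta> = der_scale p a + der_scale q b)"
proof -
  have "\<theta> \<in> module.span der_scale {a, b} \<longleftrightarrow> (\<exists>p q. \<theta> - der_scale p a - der_scale q b = 0)"
    by (simp add: Der.span_insert)
  also have "\<dots> \<longleftrightarrow> (\<exists>p q. \<theta> = der_scale p a + der_scale q b)"
    by (simp only: diff_diff_eq right_minus_eq)
  finally show ?thesis .
qed

text \<open>Determinants are multiplicative: the quotient is the determinant of the two-by-two
  matrix of coefficients.\<close>

lemma der_det_dvd:
  assumes "\<theta> \<in> module.span der_scale {a, b}" "\<eta> \<in> module.span der_scale {a, b}"
  shows "der_det a b dvd der_det \<theta> \<eta>"
proof -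
  obtain p q r s where "\<theta> = der_scale p a + der_scale q b" "\<eta> = der_scale r a + der_scale s b"
    using assms by (auto simp: mem_span_pair_iff)
  then have "der_det \<theta> \<eta> = der_det a b * (p * s - q * r)"
    by (simp add: der_det_def der_scale_def algebra_simps)
  then show ?thesis by simp
qed

text \<open>By Cramer's rule the coefficients of \<open>a\<close> and \<open>b\<close> are quotients
  of determinants. Each numerator is homogeneous, so a nonzero coefficient forces its degree to be
  at least that of \<open>der_det a b\<close>.\<close>

lemma degree_ge_of_mem_span_pair:
  fixes a b \<theta> :: "'a::{idom,ring_char_0} derivation"
  assumes \<theta>: "\<theta> \<in> module.span der_scale {a, b}" "\<theta> \<noteq> 0" and hom: "der_homogeneous k \<theta>"
    and a: "der_homogeneous ka a" and b: "der_homogeneous kb b" and nz: "der_det a b \<noteq> 0"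
  shows "ka \<le> k \<or> kb \<le> k"
proof -
  obtain p q where pq: "\<theta> = der_scale p a + der_scale q b"
    using \<theta> by (auto simp: mem_span_pair_iff)
  have 1: "der_det \<theta> b = p * der_det a b" and 2: "der_det a \<theta> = q * der_det a b"
    by (simp_all add: pq der_det_def der_scale_def algebra_simps)
  have ab: "der_det a b \<in> homogeneous_polys (ka + kb)" using a b by (rule homogeneous_der_det)
  consider "p \<noteq> 0" | "q \<noteq> 0" using pq \<theta>(2) by (cases "p = 0") (auto simp: der_scale_def zero_prod_def)
  then show ?thesis
  proof cases
    case 1
    then have "ka + kb \<le> k + kb"
      using homogeneous_left_factor(1)[of p "der_det a b"] homogeneous_der_det[OF hom b] ab nz
      unfolding \<open>der_det \<theta> b = _\<close> by blast
    then show ?thesis by simp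
  next
    case 2
    then have "ka + kb \<le> ka + k"
      using homogeneous_left_factor(1)[of q "der_det a b"] homogeneous_der_det[OF a hom] ab nz
      unfolding \<open>der_det a \<theta> = _\<close> by blast
    then show ?thesis by simp
  qed
qed

lemma independent_pairD:
  assumes "\<not> module.dependent der_scale B" "a \<in> B" "b \<in> B" "a \<noteq> b"
    "der_scale p a + der_scale q b = 0"
  shows "p = 0"
proof -
  let ?u = "\<lambda>v. if v = a then p else q"
  have "(\<Sum>v\<in>{a, b}. der_scale (?u v) v) = 0" using assms by simp
  from Der.independentD[OF assms(1) _ _ this, of a]
  show "p = 0" using assms(2-4) by auto
qed

lemma independent_tripleD:
  assumes "\<not> module.dependent der_scale B" "a \<in> B" "b \<in> B" "c \<in> B" "a \<noteq> b" "a \<noteq> c" "b \<noteq> c"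
    "der_scale p a + der_scale q b + der_scale r c = 0"
  shows "r = 0"
proof -
  let ?u = "\<lambda>v. if v = a then p else if v = b then q else r"
  have "(\<Sum>v\<in>{a, b, c}. der_scale (?u v) v) = 0" using assms by (simp add: add.assoc)
  from Der.independentD[OF assms(1) _ _ this, of c]
  show "r = 0" using assms(2-7) by auto
qed

text \<open>A vanishing determinant yields two linear relations between \<open>a\<close> and
  \<open>b\<close>, whose coefficients of \<open>a\<close> are the components of \<open>b\<close>;
  independence then gives \<open>b = 0\<close>.\<close>

lemma der_det_nonzero_of_independent:
  assumes B: "\<not> module.dependent der_scale B" and ab: "a \<in> B" "b \<in> B" "a \<noteq> b"
  shows "der_det a b \<noteq> 0"
proof
  assume "der_det a b = 0"
  then have "der_scale (fst b) a + der_scale (- fst a) b = 0"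
    "der_scale (snd b) a + der_scale (- snd a) b = 0"
    by (simp_all add: der_det_def der_scale_def prod_eq_iff algebra_simps)
  then have "fst b = 0" "snd b = 0"
    using independent_pairD[OF B ab] by blast+
  then have "b = 0" by (simp add: prod_eq_iff)
  then show False using B ab Der.dependent_zero by blast
qed

text \<open>One generator gives only zero determinants, and three derivations in rank two always
  satisfy a relation. This fixes the number of elements of any basis before degrees are
  compared.\<close>

lemma basis_is_pair:
  assumes B: "\<not> module.dependent der_scale B"
    and mem: "\<theta> \<in> module.span der_scale B" "\<eta> \<in> module.span der_scale B" and nz: "der_det \<theta> \<eta> \<noteq> 0"
  obtains a b where "B = {a, b}" "a \<noteq> b"
proof -
  have "\<exists>a\<in>B. \<exists>b\<in>B. a \<noteq> b"
  proof (rule ccontr)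
    assume "\<not> ?thesis"
    \<comment> \<open>The degenerate pair \<open>{a, a}\<close> covers the empty set and a singleton
      at once.\<close>
    then obtain a where "B \<subseteq> {a, a}" by (cases "B = {}") auto
    then have "\<theta> \<in> module.span der_scale {a, a}" "\<eta> \<in> module.span der_scale {a, a}"
      using mem Der.span_mono by blast+
    then have "der_det a a dvd der_det \<theta> \<eta>" by (rule der_det_dvd)
    then show False using nz by (simp add: der_det_def mult.commute)
  qed
  then obtain a b where ab: "a \<in> B" "b \<in> B" "a \<noteq> b" by blast
  have "c \<in> {a, b}" if c: "c \<in> B" for c
  proof (rule ccontr)
    assume "c \<notin> {a, b}"
    then have ne: "a \<noteq> c" "b \<noteq> c" by auto
    \<comment> \<open>Each component expands a three-by-three determinant with a repeated
      row.\<close>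
    have "der_scale (der_det b c) a + der_scale (- der_det a c) b + der_scale (der_det a b) c = 0"
      by (simp add: der_det_def der_scale_def prod_eq_iff algebra_simps)
    then have "der_det a b = 0"
      by (rule independent_tripleD[OF B ab(1,2) c ab(3) ne])
    then show False using der_det_nonzero_of_independent[OF B ab] by simp
  qed
  then show ?thesis using that ab by blast
qed

text \<open>The description by \<open>THE\<close> requires uniqueness over all homogeneous bases.
  The determinants of two bases divide each other, so the degree sums agree; the smallest degrees
  agree as well, because each basis lies in the span of the other.\<close>

lemma exponents_eq_pair:
  fixes \<theta> \<eta> :: "'a::{idom,ring_char_0} derivation"
  assumes M: "module.span der_scale {\<theta>, \<eta>} = M" and nz: "der_det \<theta> \<eta> \<noteq> 0"
    and \<theta>: "der_homogeneous k \<theta>" and \<eta>: "der_homogeneous l \<eta>" and "k \<le> l"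
  shows "exponents M = {#k, l#}"
proof -
  have ne: "\<theta> \<noteq> \<eta>" and "\<theta> \<noteq> 0" using nz by (auto simp: der_det_def mult.commute)
  have mem: "\<theta> \<in> M" "\<eta> \<in> M" using M Der.span_superset by blast+
  have "\<not> module.dependent der_scale {\<theta>, \<eta>}"
  proof
    assume "module.dependent der_scale {\<theta>, \<eta>}"
    then obtain u where u: "der_scale (u \<theta>) \<theta> + der_scale (u \<eta>) \<eta> = 0" "u \<theta> \<noteq> 0 \<or> u \<eta> \<noteq> 0"
      using ne by (auto simp: Der.dependent_finite)
    have "der_det (der_scale (u \<theta>) \<theta> + der_scale (u \<eta>) \<eta>) \<eta> = u \<theta> * der_det \<theta> \<eta>"
      "der_det \<theta> (der_scale (u \<theta>) \<theta> + der_scale (u \<eta>) \<eta>) = u \<eta> * der_det \<theta> \<eta>"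
      by (simp_all add: der_det_def der_scale_def algebra_simps)
    then show False using u nz by (simp add: der_det_def)
  qed
  then have "homogeneous_basis M (\<lambda>\<tau>. if \<tau> = \<theta> then k else l) {\<theta>, \<eta>}"
    using M \<theta> \<eta> by (simp add: homogeneous_basis_def)
  then have ex: "\<exists>e B. homogeneous_basis M e B \<and> {#k, l#} = image_mset e (mset_set B)"
    using ne by (intro exI[of _ "\<lambda>\<tau>. if \<tau> = \<theta> then k else l"] exI[of _ "{\<theta>, \<eta>}"]) simp
  have uniq: "image_mset e (mset_set B) = {#k, l#}" if "homogeneous_basis M e B" for e B
  proof -
    have B: "\<not> module.dependent der_scale B" "module.span der_scale B = M"
      and hom: "\<And>\<tau>. \<tau> \<in> B \<Longrightarrow> der_homogeneous (e \<tau>) \<tau>"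
      using that by (auto simp: homogeneous_basis_def)
    obtain a b where ab: "B = {a, b}" "a \<noteq> b"
      using basis_is_pair[OF B(1)] mem nz B(2) by metis
    have nz': "der_det a b \<noteq> 0" using der_det_nonzero_of_independent[OF B(1)] ab by simp
    have "a \<noteq> 0" "b \<noteq> 0" using nz' by (auto simp: der_det_def)
    have mem': "a \<in> M" "b \<in> M" using B(2) ab Der.span_superset by blast+
    have a: "der_homogeneous (e a) a" and b: "der_homogeneous (e b) b" using hom ab by auto
    have "der_det a b dvd der_det \<theta> \<eta>" using mem B(2) ab by (intro der_det_dvd) auto
    then obtain c where c: "der_det \<theta> \<eta> = c * der_det a b" by (metis dvdE mult.commute)
    have "der_det \<theta> \<eta> dvd der_det a b" using mem' M by (intro der_det_dvd) auto
    then obtain c' where c': "der_det a b = c' * der_det \<theta> \<eta>" by (metis dvdE mult.commute)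
    have h1: "der_det \<theta> \<eta> \<in> homogeneous_polys (k + l)" using \<theta> \<eta> by (rule homogeneous_der_det)
    have h2: "der_det a b \<in> homogeneous_polys (e a + e b)" using a b by (rule homogeneous_der_det)
    have "c \<noteq> 0" using c nz by auto
    then have "e a + e b \<le> k + l" using homogeneous_left_factor(1)[of c "der_det a b"] h1 h2 nz' c by auto
    moreover have "c' \<noteq> 0" using c' nz' by auto
    then have "k + l \<le> e a + e b" using homogeneous_left_factor(1)[of c' "der_det \<theta> \<eta>"] h1 h2 nz c' by auto
    \<comment> \<open>The first bound expands \<open>\<theta>\<close> in the other basis; the next
      two expand \<open>a\<close> and \<open>b\<close> in \<open>\<theta>\<close>,
      \<open>\<eta>\<close> and use \<open>k \<le> l\<close>.\<close>
    moreover have "e a \<le> k \<or> e b \<le> k"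
      using degree_ge_of_mem_span_pair[OF _ \<open>\<theta> \<noteq> 0\<close> \<theta> a b nz'] mem B(2) ab by simp
    moreover have "k \<le> e a" "k \<le> e b"
      using degree_ge_of_mem_span_pair[OF _ \<open>a \<noteq> 0\<close> a \<theta> \<eta> nz]
        degree_ge_of_mem_span_pair[OF _ \<open>b \<noteq> 0\<close> b \<theta> \<eta> nz] mem' M \<open>k \<le> l\<close> by auto
    ultimately have "e a = k \<and> e b = l \<or> e a = l \<and> e b = k" by linarith
    then show ?thesis using ab by auto
  qed
  show ?thesis unfolding exponents_def
    by (rule the_equality, rule ex) (use uniq in blast)
qed

section \<open>Divisibility conditions for D(m) and Saito's criterion\<close>

lemma all_less_4: "(\<forall>i<4. P i) \<longleftrightarrow> P 0 \<and> P 1 \<and> P 2 \<and> P (3::nat)"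
  by (auto simp: numeral_eq_Suc less_Suc_eq)

lemma mem_D_iff:
  "(\<theta> :: 'a::idom derivation) \<in> D [m1, m2, m3, m4] \<longleftrightarrow> X ^ m1 dvd fst \<theta> \<and> Y ^ m2 dvd snd \<theta> \<and>
     (X - Y) ^ m3 dvd fst \<theta> - snd \<theta> \<and> (X + Y) ^ m4 dvd fst \<theta> + snd \<theta>"
proof -
  \<comment> \<open>Additivity applied to \<open>X - Y + Y = X\<close> stands in for a rule about
    differences.\<close>
  have "dx (X - Y) = (1 :: 'a bipoly)" "dy (X - Y) = (- 1 :: 'a bipoly)"
    using dx_add[of "X - Y :: 'a bipoly" Y] dy_add[of "X - Y :: 'a bipoly" Y]
    by (simp_all add: eq_neg_iff_add_eq_0)
  then show ?thesis
    by (simp add: D_def all_less_4 linear_forms_def der_apply_def dy_add numeral_3_eq_3)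
qed

text \<open>The order at \<open>r\<close> is additive and \<open>u\<close> has order 0 there. This
  replaces a coprimality argument, as the coefficients (here K[x]) need not form a field.\<close>

lemma linear_power_dvd_cancel:
  fixes u z :: "'b::idom poly"
  assumes "[:- r, 1:] ^ k dvd u * z" "poly u r \<noteq> 0"
  shows "[:- r, 1:] ^ k dvd z"
proof (cases "z = 0")
  case False
  have "u \<noteq> 0" using assms(2) by auto
  then have "order r (u * z) = order r z"
    using False assms(2) by (simp add: order_mult order_0I)
  then show ?thesis using assms(1) False \<open>u \<noteq> 0\<close> by (simp add: order_divides)
qed simp

lemma minus_power_dvd_iff: "(- p) ^ n dvd q \<longleftrightarrow> p ^ n dvd (q :: 'b::comm_ring_1)"
  by (cases "even n") simp_all

text \<open>Up to sign, three of the four linear forms are monic linear polynomials in y, with roots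
  x, -x and 0 in K[x]; this and the next two lemmas put them into that shape.\<close>

lemma X_minus_Y_power_dvd_iff:
  "(X - Y) ^ n dvd (q :: 'a::comm_ring_1 bipoly) \<longleftrightarrow> [:- [:0, 1:], 1:] ^ n dvd q"
proof -
  have "X - Y = - [:- [:0, 1:], 1 :: 'a poly:]" by (simp add: X_def Y_def)
  then show ?thesis by (simp only: minus_power_dvd_iff)
qed

lemma X_plus_Y_eq: "X + Y = [:- [:0, - 1:], 1:]"
  by (simp add: X_def Y_def)

lemma Y_eq: "Y = [:- 0, 1:]"
  by (simp add: Y_def)

lemma poly_X [simp]: "poly X r = [:0, 1:]" and poly_Y [simp]: "poly Y r = r"
  by (simp_all add: X_def Y_def)

text \<open>The defining polynomial of the multiarrangement.\<close>

definition Q_poly :: "nat \<Rightarrow> nat \<Rightarrow> nat \<Rightarrow> nat \<Rightarrow> 'a::idom bipoly" where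
  "Q_poly m1 m2 m3 m4 = X ^ m1 * Y ^ m2 * (X - Y) ^ m3 * (X + Y) ^ m4"

text \<open>Column operations show that each power divides the determinant. The powers are then
  split off one after another, since the product of those already removed does not vanish at the
  root of the next form. The form x goes first: it is constant in y and has no root.\<close>

lemma Q_poly_dvd_der_det:
  fixes \<theta> \<eta> :: "'a::{idom,ring_char_0} derivation"
  assumes "\<theta> \<in> D [m1, m2, m3, m4]" "\<eta> \<in> D [m1, m2, m3, m4]"
  shows "Q_poly m1 m2 m3 m4 dvd der_det \<theta> \<eta>"
proof -
  let ?p = "der_det \<theta> \<eta>"
  have \<theta>: "X ^ m1 dvd fst \<theta>" "Y ^ m2 dvd snd \<theta>" "(X - Y) ^ m3 dvd fst \<theta> - snd \<theta>"
      "(X + Y) ^ m4 dvd fst \<theta> + snd \<theta>"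
    and \<eta>: "X ^ m1 dvd fst \<eta>" "Y ^ m2 dvd snd \<eta>" "(X - Y) ^ m3 dvd fst \<eta> - snd \<eta>"
      "(X + Y) ^ m4 dvd fst \<eta> + snd \<eta>"
    using assms by (auto simp: mem_D_iff)
  have 1: "X ^ m1 dvd ?p" and 2: "Y ^ m2 dvd ?p"
    unfolding der_det_def using \<theta> \<eta> by auto
  have "?p = (fst \<theta> - snd \<theta>) * snd \<eta> - snd \<theta> * (fst \<eta> - snd \<eta>)"
    by (simp add: der_det_def algebra_simps)
  then have 3: "(X - Y) ^ m3 dvd ?p" using \<theta> \<eta> by auto
  have "?p = (fst \<theta> + snd \<theta>) * snd \<eta> - snd \<theta> * (fst \<eta> + snd \<eta>)"
    by (simp add: der_det_def algebra_simps)
  then have 4: "(X + Y) ^ m4 dvd ?p" using \<theta> \<eta> by auto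
  obtain p1 where p1: "?p = X ^ m1 * p1" using 1 by (elim dvdE)
  have "Y ^ m2 dvd p1"
    using 2 unfolding p1 Y_eq by (rule linear_power_dvd_cancel) simp
  then obtain p2 where p2: "p1 = Y ^ m2 * p2" by (elim dvdE)
  have "(X - Y) ^ m3 dvd p2"
    using 3 unfolding p1 p2 X_minus_Y_power_dvd_iff mult.assoc[symmetric]
    by (rule linear_power_dvd_cancel) simp
  then obtain p3 where p3: "p2 = (X - Y) ^ m3 * p3" by (elim dvdE)
  have "(X + Y) ^ m4 dvd p3"
    using 4 unfolding p1 p2 p3 X_plus_Y_eq mult.assoc[symmetric]
    by (rule linear_power_dvd_cancel) simp
  then show ?thesis
    unfolding p1 p2 p3 Q_poly_def mult.assoc[symmetric] by (intro mult_dvd_mono) auto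
qed

text \<open>The determinant and \<open>Q_poly\<close> are homogeneous of the same degree
  \<open>|m|\<close>, so they differ by a nonzero scalar. Hence the determinant of any two members
  of the module is a multiple of \<open>der_det \<theta> \<eta>\<close>, and Cramer's rule has
  polynomial solutions.\<close>

lemma saito_criterion:
  fixes \<theta> \<eta> :: "'a::field_char_0 derivation"
  assumes mem: "\<theta> \<in> D [m1, m2, m3, m4]" "\<eta> \<in> D [m1, m2, m3, m4]"
    and hom: "der_homogeneous k \<theta>" "der_homogeneous l \<eta>" and kl: "k + l = m1 + m2 + m3 + m4"
    and nz: "der_det \<theta> \<eta> \<noteq> 0"
  shows "module.span der_scale {\<theta>, \<eta>} = D [m1, m2, m3, m4]"
proof
  let ?Q = "Q_poly m1 m2 m3 m4 :: 'a bipoly"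
  have hQ: "?Q \<in> homogeneous_polys (m1 + m2 + m3 + m4)"
    unfolding Q_poly_def
    by (intro homogeneous_mult homogeneous_power homogeneous_X homogeneous_Y homogeneous_add homogeneous_diff)
  obtain c where c: "der_det \<theta> \<eta> = c * ?Q"
    using Q_poly_dvd_der_det[OF mem] by (metis dvdE mult.commute)
  then have cQ: "c \<noteq> 0" "?Q \<noteq> 0" using nz by auto
  have "c \<in> homogeneous_polys 0"
    using homogeneous_left_factor(2)[OF _ hQ cQ, of "m1 + m2 + m3 + m4"] homogeneous_der_det[OF hom] c kl by simp
  then have c0: "coeff (coeff c j) i = 0" if "i + j \<noteq> 0" for i j
    using that unfolding homogeneous_polys_def by blast
  define c' where "c' = coeff (coeff c 0) 0"
  have "c = cst c'"
    by (intro poly_eqI) (auto simp: cst_def c'_def coeff_pCons c0 split: nat.splits)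
  then have "c' \<noteq> 0" using cQ by auto
  have Q: "?Q = cst (inverse c') * der_det \<theta> \<eta>"
    using \<open>c' \<noteq> 0\<close> unfolding c \<open>c = cst c'\<close> mult.assoc[symmetric] cst_hom(1)[symmetric] by simp
  have dvd: "der_det \<theta> \<eta> dvd der_det \<sigma> \<tau>" if "\<sigma> \<in> D [m1, m2, m3, m4]" "\<tau> \<in> D [m1, m2, m3, m4]" for \<sigma> \<tau>
    using Q_poly_dvd_der_det[OF that] unfolding Q by (rule dvd_mult_right)
  show "D [m1, m2, m3, m4] \<subseteq> module.span der_scale {\<theta>, \<eta>}"
  proof
    fix \<tau> :: "'a derivation"
    assume \<tau>: "\<tau> \<in> D [m1, m2, m3, m4]"
    obtain p where p: "der_det \<tau> \<eta> = der_det \<theta> \<eta> * p" using dvd[OF \<tau> mem(2)] by (elim dvdE)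
    obtain q where q: "der_det \<theta> \<tau> = der_det \<theta> \<eta> * q" using dvd[OF mem(1) \<tau>] by (elim dvdE)
    \<comment> \<open>Cramer's rule with denominators cleared.\<close>
    have "der_scale (der_det \<theta> \<eta>) \<tau> = der_scale (der_det \<tau> \<eta>) \<theta> + der_scale (der_det \<theta> \<tau>) \<eta>"
      by (simp add: der_det_def der_scale_def prod_eq_iff algebra_simps)
    also have "\<dots> = der_scale (der_det \<theta> \<eta>) (der_scale p \<theta> + der_scale q \<eta>)"
      unfolding p q by (simp add: der_scale_def algebra_simps)
    finally have "\<tau> = der_scale p \<theta> + der_scale q \<eta>"
      using nz by (simp add: der_scale_def prod_eq_iff)
    then show "\<tau> \<in> module.span der_scale {\<theta>, \<eta>}" by (auto simp: mem_span_pair_iff)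
  qed
  show "module.span der_scale {\<theta>, \<eta>} \<subseteq> D [m1, m2, m3, m4]"
  proof
    fix \<tau> :: "'a derivation"
    assume "\<tau> \<in> module.span der_scale {\<theta>, \<eta>}"
    then obtain p q where \<tau>: "\<tau> = der_scale p \<theta> + der_scale q \<eta>" by (auto simp: mem_span_pair_iff)
    have e: "p * a + q * b - (p * a' + q * b') = p * (a - a') + q * (b - b')"
      "p * a + q * b + (p * a' + q * b') = p * (a + a') + q * (b + b')" for a a' b b'
      by (simp_all add: algebra_simps)
    show "\<tau> \<in> D [m1, m2, m3, m4]"
      using mem unfolding mem_D_iff \<tau> by (auto simp: der_scale_def e)
  qed
qed

section \<open>Hypergeometric coefficients\<close>

lemma step2_prod_eq_pochhammer:
  fixes a :: "'a::field_char_0"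
  shows "step2_prod a n = 2 ^ n * pochhammer (a / 2) n"
  by (induction n) (simp_all add: step2_prod_def pochhammer_Suc field_simps)

lemma dfact_even: "dfact (2 * n) = 2 ^ n * fact n"
  by (induction n) (simp_all add: algebra_simps)

lemma dfact_nonzero [simp]: "dfact n \<noteq> 0"
  by (induction n rule: dfact.induct) auto

text \<open>For either parity of \<open>d\<close>, the quotient of the double factorials is
  \<open>d (d - 2) ... (d - 2 i + 2)\<close>; taking -2 out of each factor leaves a rising
  factorial.\<close>

lemma dfact_eq_pochhammer:
  assumes "2 * i \<le> d"
  shows "(of_nat (dfact d) :: 'a::field_char_0) =
    of_nat (dfact (d - 2 * i)) * (- 2) ^ i * pochhammer (- (of_nat d / 2)) i"
  using assms
proof (induction i)
  case (Suc i)
  then obtain l where d: "d = l + 2 * i + 2" by (metis add.commute le_Suc_ex mult_Suc_right add.assoc)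
  have "d - 2 * i = Suc (Suc l)" "d - 2 * Suc i = l" using d by auto
  then have *: "dfact (d - 2 * i) = Suc (Suc l) * dfact (d - 2 * Suc i)" by simp
  have l: "(of_nat (Suc (Suc l)) :: 'a) = (- 2) * (- (of_nat d / 2) + of_nat i)"
    by (simp add: d field_simps)
  have "(of_nat (dfact d) :: 'a) = of_nat (dfact (d - 2 * i)) * (- 2) ^ i * pochhammer (- (of_nat d / 2)) i"
    using Suc by simp
  then show ?case
    unfolding * of_nat_mult l pochhammer_Suc power_Suc by (simp only: mult_ac)
qed simp

text \<open>
  The coefficients of \<open>f\<^sub>m\<close> are those with \<open>d = m\<^sub>1 + 2 n\<close> and \<open>a = m\<^sub>2 - 2 n\<close>; up to a sign, those of \<open>g\<^sub>m\<close>
  arise by exchanging \<open>m\<^sub>1\<close> and \<open>m\<^sub>2\<close>.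
\<close>

definition hyp_coeff :: "nat \<Rightarrow> nat \<Rightarrow> 'a::field_char_0 \<Rightarrow> nat \<Rightarrow> 'a" where
  "hyp_coeff d n a i = (- 1) ^ i * step2_prod a (n - i) /
     of_nat (dfact (2 * n - 2 * i) * dfact (d - 2 * i) * dfact (2 * i))"

text \<open>Passing from \<open>i\<close> to \<open>i + 1\<close> removes the last factor
  \<open>b - (2 i + 2)\<close> of \<open>step2_prod\<close> and changes each double factorial by one
  factor. This is the two-term recursion behind the differential equation.\<close>

lemma hyp_coeff_Suc:
  fixes b :: "'a::field_char_0"
  assumes "i < n" "2 * n \<le> d"
  shows "of_nat (2 * i + 2) * (of_nat (2 * i + 2) - b) * hyp_coeff d n (b - of_nat (2 * n)) (Suc i) =
    of_nat (2 * n - 2 * i) * of_nat (d - 2 * i) * hyp_coeff d n (b - of_nat (2 * n)) i"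
proof -
  obtain k where n: "n = i + Suc k" using assms(1) by (metis add_Suc_right less_imp_Suc_add)
  obtain l where d: "d = l + 2 * i + 2" using assms
    by (metis add.commute add.assoc le_Suc_ex mult_Suc_right Suc_leI order_trans mult_le_mono2)
  define a where "a = b - of_nat (2 * n)"
  have a: "a + 2 * of_nat k = b - of_nat (2 * i + 2)" by (simp add: a_def n)
  have s: "step2_prod a (n - i) = step2_prod a k * (b - of_nat (2 * i + 2))"
    unfolding a[symmetric] by (simp add: n step2_prod_def)
  have e: "n - Suc i = k" "2 * n - 2 * i = Suc (Suc (2 * k))" "2 * n - 2 * Suc i = 2 * k"
    "d - 2 * i = Suc (Suc l)" "d - 2 * Suc i = l" "2 * Suc i = Suc (Suc (2 * i))"
    using n d by auto
  define w K L :: 'a where "w = of_nat (2 * i + 2)" and "K = of_nat (2 * n - 2 * i)"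
    and "L = of_nat (d - 2 * i)"
  define P M N Q :: 'a where "P = step2_prod a k" and "M = of_nat (dfact (2 * k))"
    and "N = of_nat (dfact l)" and "Q = of_nat (dfact (2 * i))"
  have nz: "w \<noteq> 0" "K \<noteq> 0" "L \<noteq> 0" "M \<noteq> 0" "N \<noteq> 0" "Q \<noteq> 0"
    unfolding w_def K_def L_def M_def N_def Q_def e by (simp_all del: of_nat_Suc of_nat_add)
  have h0: "hyp_coeff d n a i = (- 1) ^ i * (P * (b - w)) / (K * M * (L * N) * Q)"
    unfolding hyp_coeff_def s P_def K_def M_def L_def N_def Q_def w_def e(2,4) dfact.simps of_nat_mult
    by simp
  have h1: "hyp_coeff d n a (Suc i) = - ((- 1) ^ i * P / (M * N * (w * Q)))"
    unfolding hyp_coeff_def e(1,3,5) unfolding P_def M_def N_def Q_def w_def e(6) dfact.simps of_nat_mult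
    by simp
  show ?thesis
    unfolding a_def[symmetric] w_def[symmetric] K_def[symmetric] L_def[symmetric] h0 h1
    using nz by (simp add: field_simps)
qed

text \<open>Multiplied by \<open>(2 n)!! d!!\<close>, the summands become \<open>2 ^ n\<close> times
  those of the Chu-Vandermonde identity for rising factorials with parameters \<open>- d / 2\<close>
  and \<open>a / 2\<close>.\<close>

lemma sum_hyp_coeff:
  fixes a :: "'a::field_char_0"
  assumes "2 * n \<le> d"
  shows "(\<Sum>i\<le>n. hyp_coeff d n a i) =
    step2_prod (a - of_nat d) n / of_nat (dfact (2 * n) * dfact d)"
proof -
  have nz: "(of_nat (dfact j) :: 'a) \<noteq> 0" for j by simp
  have "hyp_coeff d n a i * of_nat (dfact (2 * n) * dfact d) =
      2 ^ n * (of_nat (n choose i) * pochhammer (- (of_nat d / 2)) i * pochhammer (a / 2) (n - i))"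
    if "i \<le> n" for i
  proof -
    have e: "2 * n - 2 * i = 2 * (n - i)" by simp
    have p: "(2 :: 'a) ^ n = 2 ^ (n - i) * 2 ^ i" using that by (simp flip: power_add)
    have "2 * i \<le> d" using that assms by simp
    from dfact_eq_pochhammer[OF this]
    have d: "(of_nat (dfact d) :: 'a) =
      of_nat (dfact (d - 2 * i)) * (- 2) ^ i * pochhammer (- (of_nat d / 2)) i" .
    have m: "(- 2 :: 'a) ^ i = (- 1) ^ i * 2 ^ i" by (simp flip: power_mult_distrib)
    have "(- 1 :: 'a) ^ i * (- 1) ^ i = 1" by (simp flip: power_mult_distrib)
    then have "(- 1 :: 'a) ^ i * ((- 1) ^ i * z) = z" for z by (simp flip: mult.assoc)
    then show ?thesis
      unfolding hyp_coeff_def of_nat_mult d e dfact_even step2_prod_eq_pochhammer m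
      using nz[of "d - 2 * i"] that
      by (simp add: binomial_fact p field_simps)
  qed
  then have "(\<Sum>i\<le>n. hyp_coeff d n a i) * of_nat (dfact (2 * n) * dfact d) =
      2 ^ n * pochhammer (- (of_nat d / 2) + a / 2) n"
    unfolding sum_distrib_right pochhammer_binomial_sum sum_distrib_left by (intro sum.cong) auto
  also have "- (of_nat d / 2) + a / 2 = (a - of_nat d) / 2" by (simp add: field_simps)
  finally show ?thesis
    using nz by (simp add: field_simps step2_prod_eq_pochhammer)
qed

text \<open>The factors run from \<open>- (2 n + 2 k)\<close> to \<open>- (2 k + 2)\<close>. This
  form makes the values of f and g on a line comparable.\<close>

lemma step2_prod_neg_even:
  "(step2_prod (- of_nat (2 * n + 2 * k)) n :: 'a::field_char_0) =
     (- 1) ^ n * of_nat (dfact (2 * n + 2 * k)) / of_nat (dfact (2 * k))"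
proof -
  have nz: "(of_nat (dfact (2 * k)) :: 'a) \<noteq> 0" by simp
  have m: "(- 2 :: 'a) ^ n = (- 1) ^ n * 2 ^ n" by (simp flip: power_mult_distrib)
  have "(- 1 :: 'a) ^ n * (- 1) ^ n = 1" by (simp flip: power_mult_distrib)
  then have c: "(- 1 :: 'a) ^ n * ((- 1) ^ n * z) = z" for z by (simp flip: mult.assoc)
  have "(of_nat (dfact (2 * n + 2 * k)) :: 'a) =
    of_nat (dfact (2 * k)) * (- 2) ^ n * pochhammer (- (of_nat (2 * n + 2 * k) / 2)) n"
    using dfact_eq_pochhammer[of n "2 * n + 2 * k"] by simp
  then show ?thesis
    using nz c by (simp add: step2_prod_eq_pochhammer m field_simps del: of_nat_add)
qed

text \<open>Every factor is an odd integer, hence nonzero in characteristic zero.\<close>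

lemma step2_prod_odd_nonzero:
  assumes "odd z"
  shows "(step2_prod (of_int z) n :: 'a::field_char_0) \<noteq> 0"
proof -
  have "(of_int z :: 'a) + 2 * of_nat j \<noteq> 0" for j
  proof -
    have "z + 2 * int j \<noteq> 0" using assms by presburger
    then have "(of_int (z + 2 * int j) :: 'a) \<noteq> 0" by (simp only: of_int_eq_0_iff not_False_eq_True)
    then show ?thesis by simp
  qed
  then show ?thesis by (simp add: step2_prod_def)
qed

lemma hyp_coeff_odd_nonzero:
  assumes "odd z"
  shows "(hyp_coeff d n (of_int z) i :: 'a::field_char_0) \<noteq> 0"
proof -
  have "(of_nat (dfact j) :: 'a) \<noteq> 0" for j by simp
  then show ?thesis using step2_prod_odd_nonzero[OF assms] by (simp add: hyp_coeff_def)
qed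

section \<open>The hypergeometric equation\<close>

lemma dy_cst_mult: "dy (cst c * p) = cst c * dy p"
  by (simp add: dy_def cst_def pderiv_smult)

text \<open>
  With \<open>E = y \<partial>\<^sub>y\<close> this is \<open>x\<^sup>2 E (E - m\<^sub>2) - y\<^sup>2 (E - d) (E - d + m\<^sub>1)\<close>.
\<close>

definition hyp_op :: "nat \<Rightarrow> nat \<Rightarrow> nat \<Rightarrow> 'a::idom bipoly \<Rightarrow> 'a bipoly" where
  "hyp_op m1 m2 d h = (X\<^sup>2 - Y\<^sup>2) * Y\<^sup>2 * dy (dy h)
     + ((1 - of_nat m2) * X\<^sup>2 - (1 - 2 * of_nat d + of_nat m1) * Y\<^sup>2) * Y * dy h
     - of_nat d * (of_nat d - of_nat m1) * Y\<^sup>2 * h"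

lemma hyp_op_add: "hyp_op m1 m2 d (p + q) = hyp_op m1 m2 d p + hyp_op m1 m2 d q"
  by (simp add: hyp_op_def dy_add algebra_simps)

lemma hyp_op_cst_mult: "hyp_op m1 m2 d (cst c * p) = cst c * hyp_op m1 m2 d p"
  unfolding hyp_op_def dy_cst_mult by (simp add: algebra_simps)

lemma hyp_op_0: "hyp_op m1 m2 d 0 = 0"
  by (simp add: hyp_op_def dy_def)

lemma hyp_op_sum: "hyp_op m1 m2 d (sum p I) = (\<Sum>i\<in>I. hyp_op m1 m2 d (p i))"
  by (induction I rule: infinite_finite_induct) (simp_all add: hyp_op_add hyp_op_0)

lemma Y_dy_monomial: "Y * dy (X ^ p * Y ^ e) = of_nat e * (X ^ p * Y ^ e :: 'a::idom bipoly)"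
proof -
  have "dy (X ^ p :: 'a bipoly) = 0"
    by (induction p) (simp_all add: dy_mult, simp add: dy_def)
  moreover have "Y * dy (Y ^ e) = (of_nat e * Y ^ e :: 'a bipoly)"
    by (induction e) (simp_all add: dy_mult algebra_simps, simp add: dy_def)
  ultimately show ?thesis by (simp add: dy_mult mult.left_commute)
qed

text \<open>A monomial is an eigenvector of \<open>E = y dy\<close> with eigenvalue
  \<open>e\<close>, and \<open>y^2 dy^2 = E^2 - E\<close>, so both factored parts of the operator
  act by scalars.\<close>

lemma hyp_op_monomial:
  "hyp_op m1 m2 d (X ^ p * Y ^ e) =
     of_nat e * (of_nat e - of_nat m2) * (X ^ (p + 2) * Y ^ e)
     - (of_nat e - of_nat d) * (of_nat e - of_nat d + of_nat m1) * (X ^ p * Y ^ (e + 2))"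
proof -
  define M where "M = (X ^ p * Y ^ e :: 'a bipoly)"
  have 1: "Y * dy M = of_nat e * M" by (simp add: M_def Y_dy_monomial)
  have "dy (of_nat e :: 'a bipoly) = 0" by (simp add: dy_def of_nat_poly)
  then have "dy (Y * dy M) = of_nat e * dy M" unfolding 1 by (simp add: dy_mult)
  then have "Y * dy (Y * dy M) = of_nat e * (of_nat e * M)"
    using 1 by (simp add: mult.left_commute)
  moreover have "Y * dy (Y * dy M) = Y * dy M + Y\<^sup>2 * dy (dy M)"
    by (simp add: dy_mult algebra_simps power2_eq_square)
  ultimately have 2: "Y\<^sup>2 * dy (dy M) = of_nat e * (of_nat e * M) - of_nat e * M"
    using 1 by (simp add: algebra_simps)
  have "hyp_op m1 m2 d M = (X\<^sup>2 - Y\<^sup>2) * (Y\<^sup>2 * dy (dy M))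
     + ((1 - of_nat m2) * X\<^sup>2 - (1 - 2 * of_nat d + of_nat m1) * Y\<^sup>2) * (Y * dy M)
     - of_nat d * (of_nat d - of_nat m1) * Y\<^sup>2 * M"
    by (simp add: hyp_op_def algebra_simps)
  also have "\<dots> = of_nat e * (of_nat e - of_nat m2) * (X\<^sup>2 * M)
     - (of_nat e - of_nat d) * (of_nat e - of_nat d + of_nat m1) * (Y\<^sup>2 * M)"
    unfolding 1 2 by (simp add: algebra_simps)
  finally show ?thesis by (simp add: M_def power_add power2_eq_square algebra_simps)
qed

text \<open>With \<open>d = m1 + 2 n\<close> and \<open>b = m2\<close> this is f;
  \<open>hyp_G\<close> with \<open>d = m2 + 2 n\<close> and \<open>b = m1\<close> is g up to the
  sign \<open>(-1) ^ m3\<close>. The number \<open>n\<close> replaces the halved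
  differences.\<close>

definition hyp_F :: "nat \<Rightarrow> nat \<Rightarrow> nat \<Rightarrow> 'a::field_char_0 bipoly" where
  "hyp_F d n b = (\<Sum>i\<le>n. cst (hyp_coeff d n (of_nat b - of_nat (2 * n)) i) * (X ^ (d - 2 * i) * Y ^ (2 * i)))"

definition hyp_G :: "nat \<Rightarrow> nat \<Rightarrow> nat \<Rightarrow> 'a::field_char_0 bipoly" where
  "hyp_G d n b = (\<Sum>i\<le>n. cst (hyp_coeff d n (of_nat b - of_nat (2 * n)) i) * (X ^ (2 * i) * Y ^ (d - 2 * i)))"

lemma cst_hyp_coeff_Suc:
  fixes b :: nat
  assumes "i < n" "2 * n \<le> d"
  defines "c \<equiv> \<lambda>i. cst (hyp_coeff d n (of_nat b - of_nat (2 * n)) i :: 'a::field_char_0)"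
  shows "of_nat (2 * Suc i) * (of_nat (2 * Suc i) - of_nat b) * c (Suc i) =
    (of_nat (2 * n) - of_nat (2 * i)) * (of_nat d - of_nat (2 * i)) * c i"
proof -
  have "(of_nat (2 * n - 2 * i) :: 'a bipoly) = of_nat (2 * n) - of_nat (2 * i)"
    "(of_nat (d - 2 * i) :: 'a bipoly) = of_nat d - of_nat (2 * i)"
    using assms by (auto intro!: of_nat_diff)
  then show ?thesis
    using arg_cong[OF hyp_coeff_Suc[OF assms(1,2), of "of_nat b :: 'a"], of cst]
    by (simp only: cst_hom c_def) simp
qed

text \<open>By the recursion, the two monomials produced from each term cancel against those of its
  neighbours, so the sum telescopes. The lower end vanishes by the factor \<open>2 i\<close>, the
  upper end by \<open>2 n - d + m1 = 0\<close>.\<close>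

lemma hyp_op_hyp_F:
  assumes d: "d = m1 + 2 * n"
  shows "hyp_op m1 m2 d (hyp_F d n m2 :: 'a::field_char_0 bipoly) = 0"
proof -
  define c where "c = (\<lambda>i. cst (hyp_coeff d n (of_nat m2 - of_nat (2 * n)) i :: 'a))"
  \<comment> \<open>The value 0 beyond \<open>n\<close> encodes that the last monomial has no second
    part.\<close>
  define A where "A = (\<lambda>i. if i \<le> n then of_nat (2 * i) * (of_nat (2 * i) - of_nat m2) * c i *
    (X ^ (d - 2 * i + 2) * Y ^ (2 * i)) else 0)"
  have T: "hyp_op m1 m2 d (c i * p) = c i * hyp_op m1 m2 d p" for i p
    by (simp add: c_def hyp_op_cst_mult)
  have dn: "(of_nat d :: 'a bipoly) = of_nat m1 + 2 * of_nat n" by (simp add: d)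
  have "hyp_op m1 m2 d (c i * (X ^ (d - 2 * i) * Y ^ (2 * i))) = A i - A (Suc i)" if i: "i \<le> n" for i
  proof (cases "i = n")
    case True
    then show ?thesis
      unfolding T hyp_op_monomial by (simp add: A_def dn algebra_simps)
  next
    case False
    then have e: "d - 2 * Suc i + 2 = d - 2 * i" "2 * Suc i = 2 * i + 2" "Suc i \<le> n" "i < n" "2 * n \<le> d"
      using i d by auto
    have "A (Suc i) = (of_nat (2 * n) - of_nat (2 * i)) * (of_nat d - of_nat (2 * i)) * c i *
        (X ^ (d - 2 * i) * Y ^ (2 * i + 2))"
      unfolding A_def c_def cst_hyp_coeff_Suc[OF e(4,5), symmetric] e(1) using e(3) by simp
    then show ?thesis using i
      unfolding T hyp_op_monomial by (simp add: A_def dn algebra_simps)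
  qed
  then have "hyp_op m1 m2 d (hyp_F d n m2 :: 'a bipoly) = (\<Sum>i\<le>n. A i - A (Suc i))"
    by (simp add: hyp_F_def hyp_op_sum c_def)
  also have "\<dots> = 0" unfolding sum_telescope by (simp add: A_def)
  finally show ?thesis .
qed

text \<open>Here the exponent \<open>d - 2 i\<close> of y decreases, so the two parts of the
  operator exchange roles and the telescoping sum appears with the opposite sign.\<close>

lemma hyp_op_hyp_G:
  assumes d: "d = m2 + 2 * n"
  shows "hyp_op m1 m2 d (hyp_G d n m1 :: 'a::field_char_0 bipoly) = 0"
proof -
  define c where "c = (\<lambda>i. cst (hyp_coeff d n (of_nat m1 - of_nat (2 * n)) i :: 'a))"
  define A where "A = (\<lambda>i. if i \<le> n then of_nat (2 * i) * (of_nat (2 * i) - of_nat m1) * c i *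
    (X ^ (2 * i) * Y ^ (d - 2 * i + 2)) else 0)"
  have T: "hyp_op m1 m2 d (c i * p) = c i * hyp_op m1 m2 d p" for i p
    by (simp add: c_def hyp_op_cst_mult)
  have di: "(of_nat (d - 2 * i) :: 'a bipoly) = of_nat d - 2 * of_nat i" if "i \<le> n" for i
    using that d by (simp add: of_nat_diff)
  have dn: "(of_nat d :: 'a bipoly) = of_nat m2 + 2 * of_nat n" by (simp add: d)
  have "hyp_op m1 m2 d (c i * (X ^ (2 * i) * Y ^ (d - 2 * i))) = - (A i - A (Suc i))" if i: "i \<le> n" for i
  proof (cases "i = n")
    case True
    then show ?thesis
      unfolding T hyp_op_monomial di[OF i] by (simp add: A_def dn algebra_simps)
  next
    case False
    then have e: "d - 2 * Suc i + 2 = d - 2 * i" "2 * Suc i = 2 * i + 2" "Suc i \<le> n" "i < n" "2 * n \<le> d"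
      using i d by auto
    have "A (Suc i) = (of_nat (2 * n) - of_nat (2 * i)) * (of_nat d - of_nat (2 * i)) * c i *
        (X ^ (2 * i + 2) * Y ^ (d - 2 * i))"
      unfolding A_def c_def cst_hyp_coeff_Suc[OF e(4,5), symmetric] e(1) using e(3) by simp
    then show ?thesis using i
      unfolding T hyp_op_monomial di[OF i] by (simp add: A_def dn algebra_simps)
  qed
  then have "hyp_op m1 m2 d (hyp_G d n m1 :: 'a bipoly) = - (\<Sum>i\<le>n. A i - A (Suc i))"
    by (simp add: hyp_G_def hyp_op_sum c_def flip: sum_negf)
  also have "\<dots> = 0" unfolding sum_telescope by (simp add: A_def)
  finally show ?thesis .
qed

text \<open>At \<open>r = s x\<close> the indicial expression equals \<open>2 (k - j) r^3\<close>:
  the local exponents are 0 and \<open>k\<close>, and the assumed root excludes 0.\<close>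

lemma linear_power_dvd_of_hyp_op:
  fixes h :: "'a::field_char_0 bipoly"
  assumes ode: "hyp_op m1 m2 d h = 0" and root: "poly h [:0, s:] = 0" and s: "s\<^sup>2 = 1"
    and d: "2 * d + 2 = m1 + m2 + 2 * k"
  shows "[:- [:0, s:], 1:] ^ k dvd h"
proof (rule power_dvd_of_regular_singular_ode[OF _ root])
  define r where "r = [:0, s:]"
  let ?B = "((1 - of_nat m2) * X\<^sup>2 - (1 - 2 * of_nat d + of_nat m1) * Y\<^sup>2) * Y :: 'a bipoly"
  let ?C = "- (of_nat d * (of_nat d - of_nat m1) * Y\<^sup>2) :: 'a bipoly"
  let ?A = "- ((Y + [:r:]) * Y\<^sup>2) :: 'a bipoly"
  have s': "s * s = 1" using s by (simp add: power2_eq_square)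
  have "s \<noteq> 0" using s by auto
  then have "r \<noteq> 0" by (simp add: r_def)
  have "X\<^sup>2 - Y\<^sup>2 = [:- r, 1:] * - (Y + [:r:])"
    by (simp add: X_def Y_def power2_eq_square s' r_def)
  then have "(X\<^sup>2 - Y\<^sup>2) * Y\<^sup>2 = [:- r, 1:] * ?A" by (simp only: mult_ac mult_minus_left mult_minus_right)
  then show "[:- [:0, s:], 1:] * ?A * pderiv (pderiv h) + ?B * pderiv h + ?C * h = 0"
    using ode by (simp add: hyp_op_def dy_def r_def)
  fix j :: nat
  assume j: "1 \<le> j" "j < k"
  have r2: "r\<^sup>2 = [:0, 1:]\<^sup>2" by (simp add: r_def power2_eq_square s')
  have pX: "poly X r = [:0, 1:]" and pY: "poly Y r = r" by (simp_all add: X_def Y_def)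
  have pA: "poly ?A r = - 2 * r ^ 3"
    by (simp add: pY power2_eq_square power3_eq_cube algebra_simps)
  have "poly ?B r = ((1 - of_nat m2) * [:0, 1:]\<^sup>2 - (1 - 2 * of_nat d + of_nat m1) * r\<^sup>2) * r"
    by (simp add: pX pY)
  also have "\<dots> = (2 * of_nat d - of_nat m1 - of_nat m2) * r ^ 3"
    unfolding r2[symmetric] by (simp add: power2_eq_square power3_eq_cube algebra_simps)
  also have "2 * of_nat d - of_nat m1 - of_nat m2 = (2 * of_nat k - 2 :: 'a poly)"
    using arg_cong[OF d, of "of_nat :: nat \<Rightarrow> 'a poly"] by (simp add: algebra_simps)
  finally have pB: "poly ?B r = (2 * of_nat k - 2) * r ^ 3" .
  have "of_nat (j - 1) * poly ?A r + poly ?B r = 2 * of_nat (k - j) * r ^ 3"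
    unfolding pA pB using j by (simp add: of_nat_diff algebra_simps)
  then show "of_nat (j - 1) * poly ?A [:0, s:] + poly ?B [:0, s:] \<noteq> 0"
    using j \<open>r \<noteq> 0\<close> unfolding r_def by simp
qed

section \<open>The derivations \<open>\<theta>\<^sub>m\<close>\<close>

lemma f_poly_eq:
  assumes s: "m1 + m2 + 2 * m3 = 2 * d + 2" and d: "d = m1 + 2 * n"
  shows "f_poly m1 m2 m3 = (hyp_F d n m2 :: 'a::field_char_0 bipoly)"
proof -
  have D: "sum_list [m1, m2, m3, m3] div 2 - 1 = d" using s by simp
  have n: "(d - m1) div 2 = n" "d - m1 - 2 * i = 2 * n - 2 * i" for i using d by auto
  have a: "of_int (int m1 + int m2 - int d) = (of_nat m2 - of_nat (2 * n) :: 'a)"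
    by (simp add: d)
  show ?thesis
    unfolding f_poly_def D Let_def n a hyp_F_def hyp_coeff_def cst_def
    using d by (simp add: atMost_atLeast0 mult.assoc)
qed

lemma g_poly_eq:
  assumes s: "m1 + m2 + 2 * m3 = 2 * d + 2" and d: "d = m2 + 2 * n"
  shows "g_poly m1 m2 m3 = cst ((- 1) ^ m3) * (hyp_G d n m1 :: 'a::field_char_0 bipoly)"
proof -
  have D: "sum_list [m1, m2, m3, m3] div 2 - 1 = d" using s by simp
  have n: "(d - m2) div 2 = n" "d - m2 - 2 * i = 2 * n - 2 * i" for i using d by auto
  have a: "of_int (int m1 + int m2 - int d) = (of_nat m1 - of_nat (2 * n) :: 'a)"
    by (simp add: d)
  show ?thesis
    unfolding g_poly_def D Let_def n a hyp_G_def hyp_coeff_def cst_def sum_distrib_left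
    using d by (simp add: atMost_atLeast0 power_add mult_ac)
qed

lemma f_poly_eq_0: "m1 + m2 + 2 * m3 = 2 * d + 2 \<Longrightarrow> d < m1 \<Longrightarrow> f_poly m1 m2 m3 = 0"
  by (simp add: f_poly_def Let_def)

lemma g_poly_eq_0: "m1 + m2 + 2 * m3 = 2 * d + 2 \<Longrightarrow> d < m2 \<Longrightarrow> g_poly m1 m2 m3 = 0"
  by (simp add: g_poly_def Let_def)

section \<open>Values on the lines y = x and y = -x\<close>

lemma poly_cst: "poly (cst c) r = [:c:]"
  by (simp add: cst_def)

lemma sum_const_poly: "(\<Sum>i\<in>I. [:c i:]) = [:\<Sum>i\<in>I. c i:]"
  by (induction I rule: infinite_finite_induct) auto

lemma poly_hyp_F:
  assumes "s\<^sup>2 = (1 :: 'a::field_char_0)" "2 * n \<le> d"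
  shows "poly (hyp_F d n b) [:0, s:] =
    [:step2_prod (of_nat b - of_nat (2 * n) - of_nat d) n / of_nat (dfact (2 * n) * dfact d):] * [:0, 1:] ^ d"
proof -
  have r: "[:0, s:] = [:s:] * [:0, 1:]" by simp
  have s: "[:s:]\<^sup>2 = 1" using assms(1) by (simp add: power2_eq_square one_pCons)
  have "[:0, 1:] ^ (d - 2 * i) * [:0, s:] ^ (2 * i) = [:0, 1:] ^ d" if "i \<le> n" for i
  proof -
    have "2 * i \<le> d" using that assms by simp
    have "[:s:] ^ (2 * i) = 1" by (simp add: power_mult s)
    then have "[:0, 1:] ^ (d - 2 * i) * [:0, s:] ^ (2 * i) = [:0, 1:] ^ (d - 2 * i + 2 * i)"
      unfolding r power_mult_distrib power_add by (simp only: mult_1_left)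
    then show ?thesis using \<open>2 * i \<le> d\<close> by simp
  qed
  then have "poly (hyp_F d n b) [:0, s:] =
      (\<Sum>i\<le>n. [:hyp_coeff d n (of_nat b - of_nat (2 * n)) i:] * [:0, 1:] ^ d)"
    unfolding hyp_F_def poly_sum poly_mult poly_cst poly_power poly_X poly_Y
    by (intro sum.cong) auto
  then show ?thesis
    unfolding sum_distrib_right[symmetric] sum_const_poly sum_hyp_coeff[OF assms(2)] .
qed

text \<open>All exponents of y are odd because \<open>d\<close> is, so one factor \<open>s\<close>
  survives, unlike for \<open>hyp_F\<close>.\<close>

lemma poly_hyp_G:
  assumes "s\<^sup>2 = (1 :: 'a::field_char_0)" "2 * n \<le> d" "odd d"
  shows "poly (hyp_G d n b) [:0, s:] =
    [:step2_prod (of_nat b - of_nat (2 * n) - of_nat d) n / of_nat (dfact (2 * n) * dfact d) * s:] * [:0, 1:] ^ d"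
proof -
  have r: "[:0, s:] = [:s:] * [:0, 1:]" by simp
  have s: "[:s:]\<^sup>2 = 1" using assms(1) by (simp add: power2_eq_square one_pCons)
  have "[:0, 1:] ^ (2 * i) * [:0, s:] ^ (d - 2 * i) = [:s:] * [:0, 1:] ^ d" if "i \<le> n" for i
  proof -
    have "odd (d - 2 * i)" "2 * i \<le> d" using that assms by auto
    then obtain k where k: "d - 2 * i = 2 * k + 1" by (elim oddE)
    have "[:s:] ^ (d - 2 * i) = [:s:]" unfolding k by (simp add: power_mult s)
    then have "[:0, 1:] ^ (2 * i) * [:0, s:] ^ (d - 2 * i) = [:s:] * [:0, 1:] ^ (2 * i + (d - 2 * i))"
      unfolding r power_mult_distrib power_add by (simp only: mult_ac)
    then show ?thesis using \<open>2 * i \<le> d\<close> by simp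
  qed
  then have "poly (hyp_G d n b) [:0, s:] =
      (\<Sum>i\<le>n. [:hyp_coeff d n (of_nat b - of_nat (2 * n)) i:] * ([:s:] * [:0, 1:] ^ d))"
    unfolding hyp_G_def poly_sum poly_mult poly_cst poly_power poly_X poly_Y
    by (intro sum.cong) auto
  then show ?thesis
    unfolding sum_distrib_right[symmetric] sum_const_poly sum_hyp_coeff[OF assms(2)]
    by (simp add: mult_ac)
qed

text \<open>The bound \<open>2 m_i \<le> |m| + 2\<close> reads \<open>m_i \<le> d + 2\<close>, and
  parity excludes \<open>d + 1\<close>. At \<open>d + 2\<close> the corresponding polynomial f or g
  is zero.\<close>

lemma odd_le_cases:
  fixes d m :: nat
  assumes "odd d" "odd m" "m \<le> d + 2"
  obtains "m = d + 2" | n where "d = m + 2 * n"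
proof (cases "m \<le> d")
  case True
  then have "even (d - m)" using assms by simp
  then show ?thesis using that(2) True by (metis evenE le_add_diff_inverse)
next
  case False
  moreover have "m \<noteq> d + 1" using assms by auto
  ultimately show ?thesis using that(1) assms by linarith
qed

text \<open>For \<open>s = 1\<close> and \<open>s = -1\<close> the sum is the image of x - y and of
  x + y under \<open>theta\<close>. If f and g are both nonempty sums, their values cancel; in the
  boundary cases the remaining value is itself zero.\<close>

lemma poly_f_add_g_eq_0:
  fixes s :: "'a::field_char_0"
  assumes sum: "m1 + m2 + 2 * m3 = 2 * d + 2" and "odd d" "odd m1" "odd m2"
    and le: "m1 \<le> d + 2" "m2 \<le> d + 2" and s: "s\<^sup>2 = 1" and "m3 > 0"
  shows "poly (f_poly m1 m2 m3 + cst s * g_poly m1 m2 m3) [:0, s:] = 0"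
proof -
  have s': "s * (s * z) = z" for z using s by (simp add: power2_eq_square flip: mult.assoc)
  \<comment> \<open>The product starts at \<open>2 - 2 n\<close>, so its last factor is 0.\<close>
  have vanish: "step2_prod (of_nat (d + 2) - of_nat (2 * n) - of_nat d) n = (0 :: 'a)" if "n > 0" for n
  proof -
    obtain k where "n = Suc k" using \<open>n > 0\<close> gr0_conv_Suc by blast
    then show ?thesis by (simp add: step2_prod_def)
  qed
  consider "m1 = d + 2" | "m2 = d + 2" | n n' where "d = m1 + 2 * n" "d = m2 + 2 * n'"
    by (metis odd_le_cases[OF \<open>odd d\<close> \<open>odd m1\<close> le(1)] odd_le_cases[OF \<open>odd d\<close> \<open>odd m2\<close> le(2)])
  then show ?thesis
  proof cases
    case 1
    then have d: "d = m2 + 2 * m3" using sum by simp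
    then have "2 * m3 \<le> d" by simp
    from poly_hyp_G[OF s this \<open>odd d\<close>, of m1] have "poly (hyp_G d m3 m1) [:0, s:] = 0"
      unfolding 1 vanish[OF \<open>m3 > 0\<close>] by simp
    moreover have "f_poly m1 m2 m3 = (0 :: 'a bipoly)" using f_poly_eq_0[OF sum] 1 by simp
    ultimately show ?thesis by (simp add: g_poly_eq[OF sum d])
  next
    case 2
    then have d: "d = m1 + 2 * m3" using sum by simp
    then have "2 * m3 \<le> d" by simp
    from poly_hyp_F[OF s this, of m2] have "poly (hyp_F d m3 m2) [:0, s:] = 0"
      unfolding 2 vanish[OF \<open>m3 > 0\<close>] by simp
    moreover have "g_poly m1 m2 m3 = (0 :: 'a bipoly)" using g_poly_eq_0[OF sum] 2 by simp
    ultimately show ?thesis by (simp add: f_poly_eq[OF sum d])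
  next
    case (3 n n')
    note n = 3(1) and n' = 3(2)
    have m3: "m3 = n + n' + 1" using sum n n' by simp
    have a: "of_nat m2 - of_nat (2 * n) - of_nat d = (- of_nat (2 * n + 2 * n') :: 'a)"
      by (subst n') simp
    have b: "of_nat m1 - of_nat (2 * n') - of_nat d = (- of_nat (2 * n' + 2 * n) :: 'a)"
      by (subst n) simp
    \<comment> \<open>The sign \<open>(-1) ^ m3\<close> in g is what turns equality of the two
      values into cancellation.\<close>
    have sgn: "(- 1 :: 'a) ^ m3 * (- 1) ^ n' = - ((- 1) ^ n)"
      by (simp add: m3 power_add flip: power_mult_distrib)
    have le: "2 * n \<le> d" "2 * n' \<le> d" using n n' by auto
    define A :: 'a where "A = of_nat (dfact (2 * n + 2 * n')) /
      (of_nat (dfact (2 * n)) * of_nat (dfact (2 * n')) * of_nat (dfact d))"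
    have F: "poly (hyp_F d n m2) [:0, s:] = [:(- 1) ^ n * A:] * [:0, 1:] ^ d"
      unfolding poly_hyp_F[OF s le(1)] a step2_prod_neg_even by (simp add: A_def mult_ac)
    have G: "poly (hyp_G d n' m1) [:0, s:] = [:(- 1) ^ n' * A * s:] * [:0, 1:] ^ d"
      unfolding poly_hyp_G[OF s le(2) \<open>odd d\<close>] b step2_prod_neg_even by (simp add: A_def mult_ac add.commute)
    have "s * ((- 1) ^ m3 * ((- 1) ^ n' * A * s)) = ((- 1) ^ m3 * (- 1) ^ n') * A"
      using s'[of "((- 1) ^ m3 * (- 1) ^ n') * A"] by (simp only: mult_ac)
    also have "\<dots> = - ((- 1) ^ n * A)" unfolding sgn by simp
    finally have "[:s:] * ([:(- 1) ^ m3:] * [:(- 1) ^ n' * A * s:]) = - [:(- 1) ^ n * A:]" by (simp add: mult_ac)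
    then have "[:s:] * ([:(- 1) ^ m3:] * ([:(- 1) ^ n' * A * s:] * p)) = - ([:(- 1) ^ n * A:] * p)" for p
      by (simp only: mult.assoc[symmetric] minus_mult_left)
    then show ?thesis
      unfolding f_poly_eq[OF sum n] g_poly_eq[OF sum n'] poly_add poly_mult poly_cst F G
      by (simp only: right_minus)
  qed
qed

section \<open>Behaviour along x = 0 and y = 0\<close>

lemma X_power_dvd_hyp_F: "d = m + 2 * n \<Longrightarrow> X ^ m dvd hyp_F d n b"
  unfolding hyp_F_def by (intro dvd_sum dvd_mult dvd_mult2 le_imp_power_dvd) auto

text \<open>At y = 0 the cofactor keeps only its term \<open>i = n\<close>, whose coefficient is
  nonzero because \<open>b\<close> is odd. So the order in y is exactly \<open>m\<close>.\<close>

lemma hyp_G_factor: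
  assumes d: "d = m + 2 * n" and "odd b"
  obtains v :: "'a::field_char_0 bipoly" where "hyp_G d n b = Y ^ m * v" "poly v 0 \<noteq> 0"
proof -
  define a where "a = (of_nat b - of_nat (2 * n) :: 'a)"
  define v where "v = (\<Sum>i\<le>n. cst (hyp_coeff d n a i) * (X ^ (2 * i) * Y ^ (2 * n - 2 * i)))"
  have e: "(Y :: 'a bipoly) ^ (d - 2 * i) = Y ^ m * Y ^ (2 * n - 2 * i)" if "i \<le> n" for i
    using that d by (simp flip: power_add)
  have v: "hyp_G d n b = Y ^ m * v"
    unfolding hyp_G_def v_def a_def sum_distrib_left
    by (intro sum.cong) (auto simp: e)
  have "poly v 0 = (\<Sum>i\<le>n. if i = n then [:hyp_coeff d n a i:] * [:0, 1:] ^ (2 * i) else 0)"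
    unfolding v_def poly_sum by (intro sum.cong) (auto simp: poly_cst power_0_left)
  then have "poly v 0 = [:hyp_coeff d n a n:] * [:0, 1:] ^ (2 * n)" by simp
  moreover have "a = of_int (int b - int (2 * n))" by (simp add: a_def)
  then have "hyp_coeff d n a n \<noteq> 0" using \<open>odd b\<close> by (simp only:) (rule hyp_coeff_odd_nonzero, simp)
  ultimately have "poly v 0 \<noteq> 0" by simp
  with v show ?thesis by (rule that)
qed

lemma poly_hyp_F_0_nonzero:
  assumes "odd b"
  shows "poly (hyp_F d n b :: 'a::field_char_0 bipoly) 0 \<noteq> 0"
proof -
  define a where "a = (of_nat b - of_nat (2 * n) :: 'a)"
  have "poly (hyp_F d n b) 0 = (\<Sum>i\<le>n. if i = 0 then [:hyp_coeff d n a i:] * [:0, 1:] ^ (d - 2 * i) else 0)"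
    unfolding hyp_F_def poly_sum a_def by (intro sum.cong) (auto simp: poly_cst power_0_left)
  then have "poly (hyp_F d n b) 0 = [:hyp_coeff d n a 0:] * [:0, 1:] ^ d" by simp
  moreover have "a = of_int (int b - int (2 * n))" by (simp add: a_def)
  then have "hyp_coeff d n a 0 \<noteq> 0" using \<open>odd b\<close> by (simp only:) (rule hyp_coeff_odd_nonzero, simp)
  ultimately show ?thesis by simp
qed

section \<open>Degree of \<open>theta\<close> and its membership in D(m)\<close>

lemma der_homogeneous_theta:
  assumes sum: "m1 + m2 + 2 * m3 = 2 * d + 2" and "odd d" "odd m1" "odd m2"
    and "m1 \<le> d + 2" "m2 \<le> d + 2"
  shows "der_homogeneous d (theta m1 m2 m3 :: 'a::field_char_0 derivation)"
proof -
  have mono: "cst c * (X ^ i * Y ^ j) \<in> homogeneous_polys d" if "i + j = d" for c :: 'a and i j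
    using homogeneous_mult[OF homogeneous_cst homogeneous_mult[OF
      homogeneous_power[OF homogeneous_X, of i] homogeneous_power[OF homogeneous_Y, of j]], of c] that by simp
  have "f_poly m1 m2 m3 \<in> (homogeneous_polys d :: 'a bipoly set)"
    using \<open>odd d\<close> \<open>odd m1\<close> \<open>m1 \<le> d + 2\<close>
  proof (cases rule: odd_le_cases)
    case 1
    then have "f_poly m1 m2 m3 = (0 :: 'a bipoly)" by (intro f_poly_eq_0[OF sum]) simp
    then show ?thesis by (simp add: homogeneous_0)
  next
    case (2 n)
    then show ?thesis unfolding f_poly_eq[OF sum 2] hyp_F_def
      by (intro homogeneous_sum mono) auto
  qed
  moreover have "g_poly m1 m2 m3 \<in> (homogeneous_polys d :: 'a bipoly set)"
    using \<open>odd d\<close> \<open>odd m2\<close> \<open>m2 \<le> d + 2\<close>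
  proof (cases rule: odd_le_cases)
    case 1
    then have "g_poly m1 m2 m3 = (0 :: 'a bipoly)" by (intro g_poly_eq_0[OF sum]) simp
    then show ?thesis by (simp add: homogeneous_0)
  next
    case (2 n)
    then show ?thesis
      unfolding g_poly_eq[OF sum 2] hyp_G_def sum_distrib_left mult.assoc[symmetric] cst_hom(1)[symmetric]
      unfolding mult.assoc
      by (intro homogeneous_sum mono) auto
  qed
  ultimately show ?thesis by (simp add: der_homogeneous_def theta_def homogeneous_uminus)
qed

lemma theta_mem_D:
  assumes sum: "m1 + m2 + 2 * m3 = 2 * d + 2" and odd: "odd d" "odd m1" "odd m2"
    and le: "m1 \<le> d + 2" "m2 \<le> d + 2"
  shows "theta m1 m2 m3 \<in> (D [m1, m2, m3, m3] :: 'a::field_char_0 derivation set)"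
proof -
  let ?f = "f_poly m1 m2 m3 :: 'a bipoly" and ?g = "g_poly m1 m2 m3 :: 'a bipoly"
  have f: "X ^ m1 dvd ?f \<and> hyp_op m1 m2 d ?f = 0"
    using odd(1,2) le(1)
  proof (cases rule: odd_le_cases)
    case 1
    then have "f_poly m1 m2 m3 = (0 :: 'a bipoly)" by (intro f_poly_eq_0[OF sum]) simp
    then show ?thesis by (simp add: hyp_op_0)
  next
    case (2 n)
    show ?thesis unfolding f_poly_eq[OF sum 2] using X_power_dvd_hyp_F[OF 2] hyp_op_hyp_F[OF 2] by blast
  qed
  have g: "Y ^ m2 dvd ?g \<and> hyp_op m1 m2 d ?g = 0"
    using odd(1,3) le(2)
  proof (cases rule: odd_le_cases)
    case 1
    then have "g_poly m1 m2 m3 = (0 :: 'a bipoly)" by (intro g_poly_eq_0[OF sum]) simp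
    then show ?thesis by (simp add: hyp_op_0)
  next
    case (2 n)
    obtain v :: "'a bipoly" where "hyp_G d n m1 = Y ^ m2 * v"
      using hyp_G_factor[OF 2 odd(2)] by blast
    then show ?thesis
      unfolding g_poly_eq[OF sum 2] hyp_op_cst_mult hyp_op_hyp_G[OF 2] by simp
  qed
  have "[:- [:0, s:], 1:] ^ m3 dvd ?f + cst s * ?g" if "s\<^sup>2 = 1" for s
  \<comment> \<open>For \<open>m3 = 0\<close> nothing is required, and the sum need not vanish on
    the line.\<close>
  proof (cases "m3 = 0")
    case False
    have "hyp_op m1 m2 d (?f + cst s * ?g) = 0"
      using f g by (simp add: hyp_op_add hyp_op_cst_mult)
    then show ?thesis
      using False that sum by (intro linear_power_dvd_of_hyp_op poly_f_add_g_eq_0[OF sum odd le]) auto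
  qed simp
  from this[of 1] this[of "- 1"] show ?thesis
    using f g by (simp add: mem_D_iff theta_def X_minus_Y_power_dvd_iff X_plus_Y_eq)
qed

section \<open>Nonvanishing determinants\<close>

lemma D_antimono:
  assumes "\<theta> \<in> D [m1, m2, m3, m4]" "n1 \<le> m1" "n2 \<le> m2" "n3 \<le> m3" "n4 \<le> m4"
  shows "\<theta> \<in> D [n1, n2, n3, n4]"
  using assms by (auto simp: mem_D_iff intro: power_le_dvd)

lemma f_poly_nonzero:
  assumes "m1 + m2 + 2 * m3 = 2 * d + 2" "d = m1 + 2 * n" "odd m2"
  shows "f_poly m1 m2 m3 \<noteq> (0 :: 'a::field_char_0 bipoly)"
  unfolding f_poly_eq[OF assms(1,2)] using poly_hyp_F_0_nonzero[OF assms(3), of d n] by (metis poly_0)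

lemma g_poly_factor:
  assumes "m1 + m2 + 2 * m3 = 2 * d + 2" "d = m2 + 2 * n" "odd m1"
  obtains v :: "'a::field_char_0 bipoly" where "g_poly m1 m2 m3 = Y ^ m2 * v" "poly v 0 \<noteq> 0"
proof -
  obtain w :: "'a bipoly" where w: "hyp_G d n m1 = Y ^ m2 * w" "poly w 0 \<noteq> 0"
    using hyp_G_factor[OF assms(2,3)] .
  show ?thesis
  proof (rule that)
    show "g_poly m1 m2 m3 = Y ^ m2 * (cst ((- 1) ^ m3) * w)"
      unfolding g_poly_eq[OF assms(1,2)] w(1) by (simp only: mult.left_commute)
    show "poly (cst ((- 1) ^ m3) * w) 0 \<noteq> 0" using w(2) by (simp add: poly_cst)
  qed
qed

lemma g_poly_nonzero:
  assumes "m1 + m2 + 2 * m3 = 2 * d + 2" "d = m2 + 2 * n" "odd m1"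
  shows "g_poly m1 m2 m3 \<noteq> (0 :: 'a::field_char_0 bipoly)"
proof -
  obtain v :: "'a bipoly" where "g_poly m1 m2 m3 = Y ^ m2 * v" "poly v 0 \<noteq> 0"
    using g_poly_factor[OF assms] .
  moreover have "(Y :: 'a bipoly) \<noteq> 0" by (simp add: Y_def)
  ultimately show ?thesis by auto
qed

text \<open>Orders in y are compared: one product in the determinant has order exactly
  \<open>m2\<close>, the other at least \<open>m2 + 2\<close>.\<close>

lemma der_det_theta_nonzero:
  assumes sum: "m1 + m2 + 2 * m3 = 2 * d + 2" and n: "d = m1 + 2 * n" and k: "d = m2 + 2 * k"
    and odd: "odd m1" "odd m2"
  shows "der_det (theta m1 m2 m3) (theta (m1 + 2) (m2 + 2) m3) \<noteq> (0 :: 'a::field_char_0 bipoly)"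
proof
  let ?f = "f_poly m1 m2 m3 :: 'a bipoly" and ?f' = "f_poly (m1 + 2) (m2 + 2) m3 :: 'a bipoly"
  assume 0: "der_det (theta m1 m2 m3) (theta (m1 + 2) (m2 + 2) m3) = (0 :: 'a bipoly)"
  have sum': "m1 + 2 + (m2 + 2) + 2 * m3 = 2 * (d + 2) + 2" using sum by simp
  \<comment> \<open>Both multiplicities and \<open>d\<close> grow by 2, so the summation bounds stay
    the same.\<close>
  have n': "d + 2 = m1 + 2 + 2 * n" and k': "d + 2 = m2 + 2 + 2 * k" using n k by auto
  have odd': "odd (m1 + 2)" "odd (m2 + 2)" using odd by auto
  obtain v :: "'a bipoly" where v: "g_poly m1 m2 m3 = Y ^ m2 * v" "poly v 0 \<noteq> 0"
    using g_poly_factor[OF sum k odd(1)] .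
  obtain w :: "'a bipoly" where w: "g_poly (m1 + 2) (m2 + 2) m3 = Y ^ (m2 + 2) * w"
    using g_poly_factor[OF sum' k' odd'(1)] by blast
  have f': "poly ?f' 0 \<noteq> 0"
    unfolding f_poly_eq[OF sum' n'] by (rule poly_hyp_F_0_nonzero[OF odd'(2)])
  have "Y ^ m2 * (v * ?f') = Y ^ m2 * (Y\<^sup>2 * (?f * w))"
    using 0 unfolding der_det_def theta_def fst_conv snd_conv v(1) w power_add
    by (simp add: algebra_simps)
  moreover have "(Y :: 'a bipoly) \<noteq> 0" by (simp add: Y_def)
  ultimately have "v * ?f' = Y\<^sup>2 * (?f * w)" by simp
  then have "poly (v * ?f') 0 = poly (Y\<^sup>2 * (?f * w)) 0" by simp
  then show False using v(2) f' by simp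
qed

theorem theorem3p3:
  fixes m1 m2 m3 :: nat and m :: "nat list"
  assumes "m = [m1, m2, m3, m3]"
    and "odd m1" and "odd m2"
    and "4 dvd sum_list m"
    and "\<forall>i<4. 2 * m ! i \<le> sum_list m + 2"
  shows "theta m1 m2 m3 \<in> (D m :: 'a::field_char_0 derivation set) \<and>
    exponents (D m :: 'a derivation set) = {# sum_list m div 2 - 1, sum_list m div 2 + 1 #} \<and>
    (balanced m \<longrightarrow>
      module.span der_scale {theta m1 m2 m3, theta (m1 + 2) (m2 + 2) m3} =
        (D m :: 'a derivation set))"
proof -
  note m = assms(1) and odd12 = assms(2,3)
  define d where "d = sum_list m div 2 - 1"
  obtain k where k: "sum_list m = 4 * k" using assms(4) by (elim dvdE)
  have "k > 0" using k m \<open>odd m1\<close> by (cases k) auto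
  then have d: "d = 2 * k - 1" by (simp add: d_def k)
  then have "odd d" and kd: "2 * k = d + 1" using \<open>k > 0\<close> by auto
  have sum: "m1 + m2 + 2 * m3 = 2 * d + 2" using k kd m by simp
  have exps: "sum_list m div 2 - 1 = d" "sum_list m div 2 + 1 = d + 2" using k kd by auto
  have le: "m1 \<le> d + 2" "m2 \<le> d + 2" using assms(5) sum by (simp_all add: m all_less_4)
  let ?\<theta> = "theta m1 m2 m3 :: 'a derivation"
  have mem: "?\<theta> \<in> D m" unfolding m by (rule theta_mem_D[OF sum \<open>odd d\<close> odd12 le])
  have hom: "der_homogeneous d ?\<theta>" by (rule der_homogeneous_theta[OF sum \<open>odd d\<close> odd12 le])
  \<comment> \<open>Raising the first two multiplicities by 4 in total gives degree
    \<open>d + 2\<close>, and \<open>d + (d + 2) = |m|\<close> is what Saito's criterion demands.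
    Only the choice of \<open>n1\<close>, \<open>n2\<close> with nonzero determinant
    remains.\<close>
  have basis: "module.span der_scale {?\<theta>, \<eta>} = D m \<and> exponents (D m :: 'a derivation set) = {#d, d + 2#}"
    if \<eta>: "\<eta> = theta n1 n2 m3" and n: "n1 + n2 = m1 + m2 + 4" "m1 \<le> n1" "m2 \<le> n2" "n1 \<le> d + 4" "n2 \<le> d + 4"
      "odd n1" "odd n2" and nz: "der_det ?\<theta> \<eta> \<noteq> 0" for n1 n2 \<eta>
  proof -
    have sum': "n1 + n2 + 2 * m3 = 2 * (d + 2) + 2" and "odd (d + 2)"
      and le': "n1 \<le> d + 2 + 2" "n2 \<le> d + 2 + 2" using sum n \<open>odd d\<close> by auto
    have "\<eta> \<in> D [n1, n2, m3, m3]" unfolding \<eta> by (rule theta_mem_D[OF sum' \<open>odd (d + 2)\<close> n(6,7) le'])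
    then have mem': "\<eta> \<in> D [m1, m2, m3, m3]" by (rule D_antimono) (use n in auto)
    have hom': "der_homogeneous (d + 2) \<eta>"
      unfolding \<eta> by (rule der_homogeneous_theta[OF sum' \<open>odd (d + 2)\<close> n(6,7) le'])
    have span: "module.span der_scale {?\<theta>, \<eta>} = D m"
      unfolding m by (rule saito_criterion[OF mem[unfolded m] mem' hom hom' _ nz]) (use sum in simp)
    then show ?thesis using exponents_eq_pair[OF span nz hom hom'] by simp
  qed
  have balanced: "module.span der_scale {?\<theta>, theta (m1 + 2) (m2 + 2) m3} = D m \<and>
      exponents (D m :: 'a derivation set) = {#d, d + 2#}" if le': "m1 \<le> d" "m2 \<le> d"
  proof -
    obtain n where n: "d = m1 + 2 * n"
      by (rule odd_le_cases[OF \<open>odd d\<close> \<open>odd m1\<close> le(1)]) (use le' in auto)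
    obtain n' where n': "d = m2 + 2 * n'"
      by (rule odd_le_cases[OF \<open>odd d\<close> \<open>odd m2\<close> le(2)]) (use le' in auto)
    show ?thesis
      by (rule basis[OF refl _ _ _ _ _ _ _ der_det_theta_nonzero[OF sum n n' odd12]])
        (use le' odd12 in auto)
  qed
  have "exponents (D m :: 'a derivation set) = {#d, d + 2#}"
    using \<open>odd d\<close> \<open>odd m1\<close> le(1)
  proof (cases rule: odd_le_cases)
    case 1
    then have dm2: "d = m2 + 2 * m3" using sum by simp
    have "f_poly m1 m2 m3 = (0 :: 'a bipoly)" using 1 by (intro f_poly_eq_0[OF sum]) simp
    moreover have "g_poly m1 m2 m3 \<noteq> (0 :: 'a bipoly)" by (rule g_poly_nonzero[OF sum dm2 \<open>odd m1\<close>])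
    \<comment> \<open>Here \<open>\<theta>\<close> of \<open>(m\<^sub>1 + 2, m\<^sub>2 + 2, m\<^sub>3, m\<^sub>3)\<close> is useless: its \<open>f\<close> vanishes as well.\<close>
    moreover have "f_poly m1 (m2 + 4) m3 \<noteq> (0 :: 'a bipoly)"
      by (rule f_poly_nonzero[of _ _ _ "d + 2" 0]) (use sum 1 \<open>odd m2\<close> in auto)
    ultimately have "der_det ?\<theta> (theta m1 (m2 + 4) m3) \<noteq> 0" by (simp add: der_det_def theta_def)
    from basis[OF refl _ _ _ _ _ _ _ this] show ?thesis using 1 dm2 odd12 by simp
  next
    case (2 n)
    note n = this
    from \<open>odd d\<close> \<open>odd m2\<close> le(2) show ?thesis
    proof (cases rule: odd_le_cases)
      case 1
      then have "g_poly m1 m2 m3 = (0 :: 'a bipoly)" by (intro g_poly_eq_0[OF sum]) simp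
      moreover have "f_poly m1 m2 m3 \<noteq> (0 :: 'a bipoly)" by (rule f_poly_nonzero[OF sum n \<open>odd m2\<close>])
      \<comment> \<open>The mirror image: g vanishes, so the whole increase goes to
        \<open>m1\<close>, and the new g is a single monomial.\<close>
      moreover have "g_poly (m1 + 4) m2 m3 \<noteq> (0 :: 'a bipoly)"
        by (rule g_poly_nonzero[of _ _ _ "d + 2" 0]) (use sum 1 \<open>odd m1\<close> in auto)
      ultimately have "der_det ?\<theta> (theta (m1 + 4) m2 m3) \<noteq> 0" by (simp add: der_det_def theta_def)
      from basis[OF refl _ _ _ _ _ _ _ this] show ?thesis using 1 n odd12 by simp
    next
      case (2 n')
      then show ?thesis using balanced n by simp
    qed
  qed
  \<comment> \<open>Since \<open>|m| = 2 d + 2\<close>, balancedness says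
    \<open>2 m_i \<le> 2 d + 1\<close>.\<close>
  moreover have "m1 \<le> d \<and> m2 \<le> d" if "balanced m"
    using that sum by (simp add: balanced_def m all_less_4)
  ultimately show ?thesis using mem balanced unfolding exps by simp
qed

end
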